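(* Let $\alpha>0$ and let $\nu$ be a Borel probability measure on $[0,\infty)$. The Markov process $\{X_n\}$ based on the Kendall convolution $\triangle_\alpha$ with $\Delta X_1\sim\nu$ has the following properties: on a suitable probability space there are an i.i.d. sequence $(\Delta X_n)_{n\ge1}$ with distribution $\nu$, an i.i.d. sequence $(\theta_n)$ with the Pareto distribution $\pi_{2\alpha}$, and $\{0,1\}$-valued random variables $(Q_n)_{n\geq 1}$ such that $$X_0=0,\qquad X_1=\Delta X_1,\qquad X_{n+1}=\bigl(X_n\vee\Delta X_{n+1}\bigr)\cdot\theta_n^{Q_n}\quad\text{a.e.}$$ for $n\ge1$, where $\theta_n$ is independent of $X_n\vee\Delta X_{n+1}$ and $$P(Q_n=1\mid X_n,\Delta X_{n+1})=z(X_n,\Delta X_{n+1})^\alpha,\qquad P(Q_n=0\mid X_n,\Delta X_{n+1})=1-z(X_n,\Delta X_{n+1})^\alpha,$$ with $z(x,y)=\frac{x\wedge y}{x\vee y}$. Moreover, with $v(x,y)=x\vee y$ and $\theta\sim\pi_{2\alpha}$, $$P(X_n\in A\mid X_{n-1}=x,\Delta X_n=y)=z(x,y)^\alpha\,P\bigl(v(x,y)\,\theta\in A\bigr)+\bigl(1-z(x,y)^\alpha\bigr)\mathbf{1}_A\bigl(v(x,y)\bigr)$$ for every $n\ge2$ and every Borel set $A\subseteq[0,\infty)$.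
   Context: $\vee$ and $\wedge$ denote maximum and minimum. $T_a\lambda$ denotes the law of $a\theta$ for $\theta\sim\lambda$. $\pi_{2\alpha}$ is the Pareto distribution with density $\frac{2\alpha}{x^{2\alpha+1}}\mathbf{1}_{(1,\infty)}(x)$. The Kendall convolution $\triangle_\alpha$ is the commutative, associative operation on Borel probability measures on $[0,\infty)$ determined by $$\delta_a\triangle_\alpha\delta_b=\Bigl(1-\frac{a^\alpha}{b^\alpha}\Bigr)\delta_b+\frac{a^\alpha}{b^\alpha}T_b\pi_{2\alpha}\quad(0\le a\le b,\ b>0),\qquad\delta_0\triangle_\alpha\delta_0=\delta_0,$$ and $(\lambda_1\triangle_\alpha\lambda_2)(A)=\int\!\int(\delta_x\triangle_\alpha\delta_y)(A)\,\lambda_1(dx)\lambda_2(dy)$. The Markov process based on $\triangle_\alpha$ with step distribution $\nu$ (the Kendall random walk) is the Markov process $\{X_n:n\in\mathbb{N}_0\}$ with $X_0=0$ and transition probabilities $P(X_n\in A\mid X_k=x)=\bigl(\delta_x\triangle_\alpha\nu^{\triangle_\alpha(n-k)}\bigr)(A)$ for $k<n$, $x\ge0$; in particular $X_n$ has law $\nu^{\triangle_\alpha n}$. The step $\Delta X_{n+1}$ is independent of $X_n$, and $\theta_n$ is independent of $X_n$ and $\Delta X_{n+1}$. Convention: $z(0,0)=0$. *)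

theory Defs
  imports "HOL-Probability.Probability"
begin

text \<open>
  Borel probability measures on the half-line are represented as probability measures
  on the Borel sets of the reals that give no mass to the negative numbers.
\<close>

definition prob_on_nonneg :: "real measure \<Rightarrow> bool" where
  "prob_on_nonneg \<nu> \<longleftrightarrow> prob_space \<nu> \<and> sets \<nu> = sets borel \<and> emeasure \<nu> {..<0} = 0"

definition scale_law :: "real \<Rightarrow> real measure \<Rightarrow> real measure" where
  "scale_law a \<mu> = distr \<mu> borel (\<lambda>t. a * t)"

definition pareto :: "real \<Rightarrow> real measure" where
  "pareto \<beta> = density lborel (\<lambda>x. ennreal (\<beta> / x powr (\<beta> + 1) * indicator {1<..} x))"

text \<open>
  The convolution of two point masses: the mixture is written as a Bernoulli choice
  between the two components. Only nonnegative arguments are meaningful.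
\<close>

definition kendall_point :: "real \<Rightarrow> real \<Rightarrow> real \<Rightarrow> real measure" where
  "kendall_point \<alpha> x y =
     (let a = min x y; b = max x y in
      if b = 0 then return borel 0
      else measure_pmf (bernoulli_pmf (a powr \<alpha> / b powr \<alpha>)) \<bind>
             (\<lambda>c. if c then scale_law b (pareto (2 * \<alpha>)) else return borel b))"

definition kendall_conv :: "real \<Rightarrow> real measure \<Rightarrow> real measure \<Rightarrow> real measure" where
  "kendall_conv \<alpha> \<mu>1 \<mu>2 = \<mu>1 \<bind> (\<lambda>x. \<mu>2 \<bind> (\<lambda>y. kendall_point \<alpha> x y))"

primrec kendall_power :: "real \<Rightarrow> real measure \<Rightarrow> nat \<Rightarrow> real measure" where
  "kendall_power \<alpha> \<nu> 0 = return borel 0"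
| "kendall_power \<alpha> \<nu> (Suc n) = kendall_conv \<alpha> (kendall_power \<alpha> \<nu> n) \<nu>"

text \<open>Conditional probability of the event \<open>E\<close> given the random variable \<open>Y\<close> with values in \<open>N\<close>.\<close>

definition cond_prob_given ::
    "'w measure \<Rightarrow> 'w set \<Rightarrow> 'b measure \<Rightarrow> ('w \<Rightarrow> 'b) \<Rightarrow> 'w \<Rightarrow> real" where
  "cond_prob_given M E N Y = real_cond_exp M (vimage_algebra (space M) Y N) (indicator E)"

text \<open>
  Independence of two random variables with values in possibly different types
  (the library's \<open>indep_var\<close> requires a common value type).
\<close>

definition indep_rv ::
    "'w measure \<Rightarrow> 'a measure \<Rightarrow> ('w \<Rightarrow> 'a) \<Rightarrow> 'b measure \<Rightarrow> ('w \<Rightarrow> 'b) \<Rightarrow> bool" where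
  "indep_rv M S X T Y \<longleftrightarrow>
     X \<in> measurable M S \<and> Y \<in> measurable M T \<and>
     prob_space.indep_set M {X -` A \<inter> space M |A. A \<in> sets S} {Y -` B \<inter> space M |B. B \<in> sets T}"

text \<open>
  The transition probabilities are required conditionally on the whole past
  \<open>X 0, \<dots>, X k\<close>; this comprises the Markov property.
\<close>

definition kendall_random_walk ::
    "real \<Rightarrow> real measure \<Rightarrow> 'w measure \<Rightarrow> (nat \<Rightarrow> 'w \<Rightarrow> real) \<Rightarrow> bool" where
  "kendall_random_walk \<alpha> \<nu> M X \<longleftrightarrow>
     prob_space M \<and>
     (\<forall>n. X n \<in> borel_measurable M) \<and>
     (\<forall>n. \<forall>\<omega>\<in>space M. 0 \<le> X n \<omega>) \<and>
     (AE \<omega> in M. X 0 \<omega> = 0) \<and>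
     (\<forall>k n. k < n \<longrightarrow> (\<forall>A\<in>sets borel.
        AE \<omega> in M.
          cond_prob_given M {\<omega>'\<in>space M. X n \<omega>' \<in> A}
            (\<Pi>\<^sub>M i\<in>{..k}. borel) (\<lambda>\<omega>'. \<lambda>i\<in>{..k}. X i \<omega>') \<omega> =
          measure (kendall_conv \<alpha> (return borel (X k \<omega>)) (kendall_power \<alpha> \<nu> (n - k))) A))"

definition path_law :: "'w measure \<Rightarrow> (nat \<Rightarrow> 'w \<Rightarrow> real) \<Rightarrow> (nat \<Rightarrow> real) measure" where
  "path_law M X = distr M (\<Pi>\<^sub>M n\<in>UNIV. borel) (\<lambda>\<omega> n. X n \<omega>)"

text \<open>The convention \<open>kendall_z 0 0 = 0\<close> is covered by \<open>0 / 0 = 0\<close>.\<close>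

definition kendall_z :: "real \<Rightarrow> real \<Rightarrow> real" where
  "kendall_z x y = min x y / max x y"

definition kendall_v :: "real \<Rightarrow> real \<Rightarrow> real" where
  "kendall_v x y = max x y"


subsection \<open>Consistency of the definitions\<close>

lemma sets_pareto [measurable_cong]: "sets (pareto \<beta>) = sets borel"
  by (simp add: pareto_def)

lemma prob_space_pareto:
  assumes "\<beta> > 0"
  shows "prob_space (pareto \<beta>)"
proof
  have "emeasure (pareto \<beta>) (space (pareto \<beta>)) =
      (\<integral>\<^sup>+x. ennreal (\<beta> / x powr (\<beta> + 1) * indicator {1<..} x) \<partial>lborel)"
    by (simp add: pareto_def emeasure_density)
  also have "\<dots> = (\<integral>\<^sup>+x. ennreal (\<beta> / x powr (\<beta> + 1)) * indicator {1..} x \<partial>lborel)"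
  proof (rule nn_integral_cong_AE)
    show "AE x in lborel. ennreal (\<beta> / x powr (\<beta> + 1) * indicator {1<..} x) =
        ennreal (\<beta> / x powr (\<beta> + 1)) * indicator {1..} x"
      using AE_lborel_singleton[of "1 :: real"]
      by eventually_elim (auto split: split_indicator)
  qed
  also have "\<dots> = ennreal (0 - (- (1 powr - \<beta>)))"
  proof (rule nn_integral_FTC_atLeast)
    show "DERIV (\<lambda>x. - (x powr - \<beta>)) x :> \<beta> / x powr (\<beta> + 1)" if "1 \<le> x" for x :: real
      using that
      by (auto intro!: derivative_eq_intros simp: powr_diff powr_minus powr_add field_simps)
    show "((\<lambda>x::real. - (x powr - \<beta>)) \<longlongrightarrow> 0) at_top"
      using tendsto_neg_powr[of "- \<beta>" "\<lambda>x. x" at_top] assms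
        tendsto_minus[of "\<lambda>x::real. x powr - \<beta>" 0 at_top]
      by (simp add: filterlim_ident)
  qed (use assms in auto)
  finally show "emeasure (pareto \<beta>) (space (pareto \<beta>)) = 1"
    by simp
qed

lemma sets_kendall_point [simp]: "sets (kendall_point \<alpha> x y) = sets borel"
  by (auto simp: kendall_point_def Let_def scale_law_def intro!: sets_bind)

lemma prob_space_scale_law_pareto:
  assumes "\<alpha> > 0"
  shows "prob_space (scale_law b (pareto (2 * \<alpha>)))"
  unfolding scale_law_def
  by (rule prob_space.prob_space_distr[OF prob_space_pareto]) (use assms in auto)

lemma kendall_component_measurable:
  assumes "\<alpha> > 0"
  shows "(\<lambda>c. if c then scale_law b (pareto (2 * \<alpha>)) else return borel b)
           \<in> measurable (measure_pmf p) (prob_algebra borel)"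
  using prob_space_scale_law_pareto[OF assms]
  by (auto simp: space_prob_algebra scale_law_def prob_space_return)

lemma kendall_point_mixture:
  assumes "\<alpha> > 0" "0 \<le> a" "a \<le> b" "0 < b" "A \<in> sets borel"
  shows "emeasure (kendall_point \<alpha> a b) A =
      ennreal (1 - a powr \<alpha> / b powr \<alpha>) * emeasure (return borel b) A +
      ennreal (a powr \<alpha> / b powr \<alpha>) * emeasure (scale_law b (pareto (2 * \<alpha>))) A"
proof -
  have p: "0 \<le> a powr \<alpha> / b powr \<alpha>" "a powr \<alpha> / b powr \<alpha> \<le> 1"
    using assms by (auto simp: divide_le_eq intro!: powr_mono2)
  have "emeasure (kendall_point \<alpha> a b) A =
      (\<integral>\<^sup>+c. emeasure (if c then scale_law b (pareto (2 * \<alpha>)) else return borel b) A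
         \<partial>measure_pmf (bernoulli_pmf (a powr \<alpha> / b powr \<alpha>)))"
    using assms measurable_prob_algebraD[OF kendall_component_measurable[OF assms(1)]]
    by (auto simp: kendall_point_def min_def max_def Let_def intro!: emeasure_bind)
  also have "\<dots> = ennreal (1 - a powr \<alpha> / b powr \<alpha>) * emeasure (return borel b) A +
      ennreal (a powr \<alpha> / b powr \<alpha>) * emeasure (scale_law b (pareto (2 * \<alpha>))) A"
    using p by (simp add: mult.commute add.commute)
  finally show "emeasure (kendall_point \<alpha> a b) A =
      ennreal (1 - a powr \<alpha> / b powr \<alpha>) * emeasure (return borel b) A +
      ennreal (a powr \<alpha> / b powr \<alpha>) * emeasure (scale_law b (pareto (2 * \<alpha>))) A" .
qed

lemma kendall_point_commute: "kendall_point \<alpha> x y = kendall_point \<alpha> y x"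
  by (simp add: kendall_point_def min.commute max.commute)

lemma kendall_point_zero: "kendall_point \<alpha> 0 0 = return borel 0"
  by (simp add: kendall_point_def)

lemma bernoulli_pmf_measurable:
  "(\<lambda>p. measure_pmf (bernoulli_pmf p)) \<in> measurable borel (prob_algebra (count_space UNIV))"
proof (rule measurable_prob_algebraI[OF _ measurable_subprob_algebra])
  fix A :: "bool set"
  have eq: "pmf (bernoulli_pmf p) b = (if b then min 1 (max 0 p) else 1 - min 1 (max 0 p))" for p b
    by (simp add: bernoulli_pmf.rep_eq)
  have "emeasure (measure_pmf (bernoulli_pmf p)) A = ennreal (\<Sum>b\<in>A. pmf (bernoulli_pmf p) b)" for p
    by (simp add: measure_pmf.emeasure_eq_measure measure_measure_pmf_finite)
  then show "(\<lambda>p. emeasure (measure_pmf (bernoulli_pmf p)) A) \<in> borel_measurable borel"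
    by (auto simp: eq)
qed (auto simp: measure_pmf.subprob_space_axioms measure_pmf.prob_space_axioms)

lemma kendall_point_measurable:
  assumes "\<alpha> > 0"
  shows "(\<lambda>(x, y). kendall_point \<alpha> x y) \<in> measurable (borel \<Otimes>\<^sub>M borel) (prob_algebra borel)"
proof -
  note bernoulli_pmf_measurable [measurable]
  have [measurable]: "(\<lambda>_. pareto (2 * \<alpha>)) \<in> measurable N (prob_algebra borel)" for N :: "'b measure"
    using prob_space_pareto[of "2 * \<alpha>"] assms by (auto simp: space_prob_algebra sets_pareto)
  have [measurable]: "(\<lambda>w. scale_law (f w) (pareto (2 * \<alpha>))) \<in> measurable N (prob_algebra borel)"
    if [measurable]: "f \<in> borel_measurable N" for f and N :: "'b measure"
    unfolding scale_law_def by measurable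
  have [measurable]: "(\<lambda>w. return borel (f w)) \<in> measurable N (prob_algebra borel)"
    if [measurable]: "f \<in> borel_measurable N" for f :: "_ \<Rightarrow> real" and N :: "'b measure"
    by measurable
  show ?thesis
    unfolding kendall_point_def Let_def by measurable
qed

lemma emeasure_kendall_conv:
  assumes "\<alpha> > 0" "prob_space \<mu>1" "sets \<mu>1 = sets borel" "prob_space \<mu>2" "sets \<mu>2 = sets borel"
    and "A \<in> sets borel"
  shows "emeasure (kendall_conv \<alpha> \<mu>1 \<mu>2) A =
      (\<integral>\<^sup>+x. (\<integral>\<^sup>+y. emeasure (kendall_point \<alpha> x y) A \<partial>\<mu>2) \<partial>\<mu>1)"
proof -
  note kendall_point_measurable[OF assms(1), measurable] and assms(3,5)[measurable_cong]
  have ne: "space \<mu>1 \<noteq> {}" "space \<mu>2 \<noteq> {}"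
    using assms by (auto simp: prob_space.not_empty)
  have [measurable]: "(\<lambda>_. \<mu>2) \<in> measurable borel (prob_algebra borel)"
    using assms by (auto simp: space_prob_algebra)
  have inner: "kendall_point \<alpha> x \<in> measurable \<mu>2 (subprob_algebra borel)" for x
    by (rule measurable_prob_algebraD) measurable
  have outer: "(\<lambda>x. \<mu>2 \<bind> kendall_point \<alpha> x) \<in> measurable \<mu>1 (subprob_algebra borel)"
    by (rule measurable_prob_algebraD) measurable
  show ?thesis
    unfolding kendall_conv_def
    by (simp add: emeasure_bind[OF ne(1) outer assms(6)] emeasure_bind[OF ne(2) inner assms(6)])
qed

end

theory Submission
  imports Defs
begin

text \<open>
  The probability space is a countable product whose coordinate \<open>n\<close> carries independent
  variables \<open>\<Delta>X\<^sub>n\<^sub>+\<^sub>1 \<sim> \<nu>\<close>, \<open>\<theta>\<^sub>n \<sim> \<pi>\<^sub>2\<^sub>\<alpha>\<close> and a uniform \<open>U\<^sub>n\<close>. On it the walk is defined by the recursion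
  \<open>X\<^sub>n\<^sub>+\<^sub>1 = max X\<^sub>n \<Delta>X\<^sub>n\<^sub>+\<^sub>1 \<cdot> \<theta>\<^sub>n ^ Q\<^sub>n\<close> with \<open>Q\<^sub>n = 1\<close> iff \<open>U\<^sub>n < z(X\<^sub>n, \<Delta>X\<^sub>n\<^sub>+\<^sub>1)\<^sup>\<alpha>\<close>. Since \<open>X\<^sub>n\<close> depends only on
  the coordinates below \<open>n\<close>, it is independent of coordinate \<open>n\<close>
  (\<open>nn_integral_fresh_noise\<close>, \<open>nn_integral_fresh_coin\<close>). All independence statements and the
  conditional laws of \<open>Q\<^sub>n\<close> and \<open>X\<^sub>n\<^sub>+\<^sub>1\<close> follow by integrating out \<open>(\<theta>\<^sub>n, U\<^sub>n)\<close>
  (\<open>cond_prob_given_switch\<close>).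

  By construction one step of this recursion has the kernel \<open>x \<mapsto> \<delta>\<^sub>x \<triangle> \<nu>\<close>
  (\<open>nn_integral_kendall_step\<close>), because a mixture of \<open>\<delta>\<^sub>b\<close> and the scaled Pareto law is how
  \<open>\<delta>\<^sub>a \<triangle> \<delta>\<^sub>b\<close> is defined. A Kendall random walk must however have the transition laws
  \<open>\<delta>\<^sub>x \<triangle> \<nu>\<^sup>n\<^sup>-\<^sup>k\<close> for all \<open>k < n\<close>, whereas iterating the kernel gives \<open>((\<delta>\<^sub>x \<triangle> \<nu>) \<triangle> \<nu>) \<dots> \<triangle> \<nu>\<close>. The two agree by
  associativity of \<open>\<triangle>\<close> (\<open>kendall_conv_assoc\<close>), which is the analytic core. It is proved with
  the Williamson transform \<open>\<integral> (1 - (x / t)\<^sup>\<alpha>)\<^sub>+ d\<mu>\<close>, which plays the role of the characteristic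
  function: it turns \<open>\<triangle>\<close> into multiplication (\<open>williamson_kendall_conv\<close>) and is injective on
  probability measures on the half-line (\<open>prob_on_nonneg_eqI_williamson\<close>).

  Uniqueness in law is the usual argument for Markov processes: the kernel determines the
  finite-dimensional laws, and these determine the law on path space
  (\<open>kendall_random_walk_path_law_unique\<close>).
\<close>

section \<open>The Williamson transform\<close>

text \<open>
  The Williamson transform \<open>\<integral> (1 - (x / t)\<^sup>\<alpha>)\<^sub>+ d\<mu>\<close>. The positive part is taken by \<open>ennreal\<close>,
  which sends negative reals to \<open>0\<close>.
\<close>

definition williamson :: "real \<Rightarrow> real \<Rightarrow> real measure \<Rightarrow> ennreal" where
  "williamson \<alpha> t \<mu> = (\<integral>\<^sup>+x. ennreal (1 - (x / t) powr \<alpha>) \<partial>\<mu>)"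

lemma AE_nonneg_prob_on_nonneg:
  assumes "prob_on_nonneg \<mu>"
  shows "AE x in \<mu>. 0 \<le> x"
proof (rule AE_I)
  show "emeasure \<mu> {..<0} = 0" and "{..<0} \<in> sets \<mu>"
    using assms by (auto simp: prob_on_nonneg_def)
qed auto

lemma prob_on_nonneg_return: "0 \<le> x \<Longrightarrow> prob_on_nonneg (return borel x)"
  by (auto simp: prob_on_nonneg_def prob_space_return)

text \<open>
  Why the transform determines the measure: for \<open>s < t\<close> the increment
  \<open>(t\<^sup>\<alpha> - x\<^sup>\<alpha>)\<^sub>+ - (s\<^sup>\<alpha> - x\<^sup>\<alpha>)\<^sub>+\<close> equals the constant \<open>t\<^sup>\<alpha> - s\<^sup>\<alpha>\<close> for \<open>x \<le> s\<close>, vanishes for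
  \<open>x \<ge> t\<close>, and lies in between otherwise. So the increments of the unnormalised transform
  squeeze the distribution function; this lemma and the next one give the two sides.
\<close>

lemma williamson_ge_cdf:
  assumes \<mu>: "prob_on_nonneg \<mu>" and st: "0 \<le> s" "s < t" and "\<alpha> > 0"
  shows "(\<integral>\<^sup>+x. ennreal (s powr \<alpha> - x powr \<alpha>) \<partial>\<mu>) + ennreal (t powr \<alpha> - s powr \<alpha>) * emeasure \<mu> {..s}
         \<le> (\<integral>\<^sup>+x. ennreal (t powr \<alpha> - x powr \<alpha>) \<partial>\<mu>)"
proof -
  have [measurable_cong]: "sets \<mu> = sets borel"
    using \<mu> by (simp add: prob_on_nonneg_def)
  have "(\<integral>\<^sup>+x. ennreal (s powr \<alpha> - x powr \<alpha>) \<partial>\<mu>) + ennreal (t powr \<alpha> - s powr \<alpha>) * emeasure \<mu> {..s} =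
      (\<integral>\<^sup>+x. ennreal (s powr \<alpha> - x powr \<alpha>) + ennreal (t powr \<alpha> - s powr \<alpha>) * indicator {..s} x \<partial>\<mu>)"
    by (simp add: nn_integral_add nn_integral_cmult_indicator)
  also have "\<dots> \<le> (\<integral>\<^sup>+x. ennreal (t powr \<alpha> - x powr \<alpha>) \<partial>\<mu>)"
  proof (rule nn_integral_mono_AE)
    have *: "s powr \<alpha> \<le> t powr \<alpha>" using assms by (intro powr_mono2) auto
    show "AE x in \<mu>. ennreal (s powr \<alpha> - x powr \<alpha>) + ennreal (t powr \<alpha> - s powr \<alpha>) * indicator {..s} x
        \<le> ennreal (t powr \<alpha> - x powr \<alpha>)"
      using AE_nonneg_prob_on_nonneg[OF \<mu>]
    proof eventually_elim
      case (elim x)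
      show ?case
      proof (cases "x \<le> s")
        case True
        with elim have "x powr \<alpha> \<le> s powr \<alpha>" using assms by (intro powr_mono2) auto
        with True * show ?thesis by (simp flip: ennreal_plus)
      next
        case False
        with * show ?thesis by (auto intro!: ennreal_leI)
      qed
    qed
  qed
  finally show ?thesis .
qed

lemma williamson_le_cdf:
  assumes \<mu>: "prob_on_nonneg \<mu>" and st: "0 \<le> s" "s < t" and "\<alpha> > 0"
  shows "(\<integral>\<^sup>+x. ennreal (t powr \<alpha> - x powr \<alpha>) \<partial>\<mu>)
         \<le> (\<integral>\<^sup>+x. ennreal (s powr \<alpha> - x powr \<alpha>) \<partial>\<mu>) + ennreal (t powr \<alpha> - s powr \<alpha>) * emeasure \<mu> {..t}"
proof -
  have [measurable_cong]: "sets \<mu> = sets borel"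
    using \<mu> by (simp add: prob_on_nonneg_def)
  have "(\<integral>\<^sup>+x. ennreal (t powr \<alpha> - x powr \<alpha>) \<partial>\<mu>) \<le>
      (\<integral>\<^sup>+x. ennreal (s powr \<alpha> - x powr \<alpha>) + ennreal (t powr \<alpha> - s powr \<alpha>) * indicator {..t} x \<partial>\<mu>)"
  proof (rule nn_integral_mono_AE)
    have *: "s powr \<alpha> \<le> t powr \<alpha>" using assms by (intro powr_mono2) auto
    show "AE x in \<mu>. ennreal (t powr \<alpha> - x powr \<alpha>)
        \<le> ennreal (s powr \<alpha> - x powr \<alpha>) + ennreal (t powr \<alpha> - s powr \<alpha>) * indicator {..t} x"
      using AE_nonneg_prob_on_nonneg[OF \<mu>]
    proof eventually_elim
      case (elim x)
      show ?case
      proof (cases "x \<le> t")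
        case True
        have "t powr \<alpha> - x powr \<alpha> \<le> max 0 (s powr \<alpha> - x powr \<alpha>) + (t powr \<alpha> - s powr \<alpha>)"
          by simp
        then have "ennreal (t powr \<alpha> - x powr \<alpha>)
            \<le> ennreal (max 0 (s powr \<alpha> - x powr \<alpha>)) + ennreal (t powr \<alpha> - s powr \<alpha>)"
          using * by (subst ennreal_plus[symmetric]) (simp_all only: ennreal_leI max.cobounded1 diff_ge_0_iff_ge)
        also have "ennreal (max 0 (s powr \<alpha> - x powr \<alpha>)) = ennreal (s powr \<alpha> - x powr \<alpha>)"
          by (auto simp: max_def ennreal_neg)
        finally show ?thesis using True by simp
      next
        case False
        then have "t powr \<alpha> \<le> x powr \<alpha>" using assms by (intro powr_mono2) auto
        then show ?thesis by (simp add: ennreal_neg)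
      qed
    qed
  qed
  also have "\<dots> = (\<integral>\<^sup>+x. ennreal (s powr \<alpha> - x powr \<alpha>) \<partial>\<mu>) + ennreal (t powr \<alpha> - s powr \<alpha>) * emeasure \<mu> {..t}"
    by (simp add: nn_integral_add nn_integral_cmult_indicator)
  finally show ?thesis .
qed

lemma williamson_scaled:
  assumes "prob_on_nonneg \<mu>" "0 < t"
  shows "(\<integral>\<^sup>+x. ennreal (t powr \<alpha> - x powr \<alpha>) \<partial>\<mu>) = ennreal (t powr \<alpha>) * williamson \<alpha> t \<mu>"
proof -
  have [measurable_cong]: "sets \<mu> = sets borel"
    using assms by (simp add: prob_on_nonneg_def)
  have "(\<integral>\<^sup>+x. ennreal (t powr \<alpha> - x powr \<alpha>) \<partial>\<mu>) =
      (\<integral>\<^sup>+x. ennreal (t powr \<alpha>) * ennreal (1 - (x / t) powr \<alpha>) \<partial>\<mu>)"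
  proof (rule nn_integral_cong_AE)
    show "AE x in \<mu>. ennreal (t powr \<alpha> - x powr \<alpha>) = ennreal (t powr \<alpha>) * ennreal (1 - (x / t) powr \<alpha>)"
      using AE_nonneg_prob_on_nonneg[OF assms(1)]
    proof eventually_elim
      case (elim x)
      have "t powr \<alpha> - x powr \<alpha> = t powr \<alpha> * (1 - (x / t) powr \<alpha>)"
        using elim assms by (simp add: powr_divide field_simps)
      then show ?case by (simp add: ennreal_mult')
    qed
  qed
  also have "\<dots> = ennreal (t powr \<alpha>) * williamson \<alpha> t \<mu>"
    unfolding williamson_def by (rule nn_integral_cmult) simp
  finally show ?thesis .
qed

text \<open>
  Equal transforms have equal increments, so the lower bound for \<open>\<mu>\<close> and the upper bound for
  \<open>\<nu>\<close> can be chained and the positive factor \<open>t\<^sup>\<alpha> - s\<^sup>\<alpha>\<close> cancelled.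
\<close>

lemma emeasure_atMost_mono_of_williamson:
  assumes \<mu>: "prob_on_nonneg \<mu>" and \<nu>: "prob_on_nonneg \<nu>" and "\<alpha> > 0"
    and eq: "\<And>t. 0 < t \<Longrightarrow> williamson \<alpha> t \<mu> = williamson \<alpha> t \<nu>"
    and st: "0 \<le> s" "s < t"
  shows "emeasure \<mu> {..s} \<le> emeasure \<nu> {..t}"
proof -
  let ?W = "\<lambda>\<mu> t. \<integral>\<^sup>+x. ennreal (t powr \<alpha> - x powr \<alpha>) \<partial>\<mu>"
  have [measurable_cong]: "sets \<nu> = sets borel"
    using \<nu> by (simp add: prob_on_nonneg_def)
  have same: "?W \<mu> r = ?W \<nu> r" if "0 \<le> r" for r
  proof (cases "r = 0")
    case True then show ?thesis by (simp add: ennreal_neg)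
  next
    case False
    with that show ?thesis
      using \<mu> \<nu> by (simp add: williamson_scaled eq)
  qed
  let ?c = "ennreal (t powr \<alpha> - s powr \<alpha>)"
  have "?W \<nu> s \<le> (\<integral>\<^sup>+x. ennreal (s powr \<alpha>) \<partial>\<nu>)"
    by (intro nn_integral_mono ennreal_leI) simp
  also have "\<dots> < \<infinity>"
    using \<nu> by (simp add: prob_on_nonneg_def prob_space.emeasure_space_1)
  finally have fin: "?W \<nu> s < \<infinity>" .
  have "?W \<nu> s + ?c * emeasure \<mu> {..s} = ?W \<mu> s + ?c * emeasure \<mu> {..s}"
    using st by (simp add: same)
  also have "\<dots> \<le> ?W \<mu> t"
    using williamson_ge_cdf[OF \<mu> st \<open>\<alpha> > 0\<close>] .
  also have "\<dots> = ?W \<nu> t"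
    using st by (simp add: same)
  also have "\<dots> \<le> ?W \<nu> s + ?c * emeasure \<nu> {..t}"
    using williamson_le_cdf[OF \<nu> st \<open>\<alpha> > 0\<close>] .
  finally have "?c * emeasure \<mu> {..s} \<le> ?c * emeasure \<nu> {..t}"
    using fin by (auto simp: ennreal_add_left_cancel_le)
  moreover have "0 < ?c"
    using st \<open>\<alpha> > 0\<close> powr_less_mono2[of \<alpha> s t] by simp
  ultimately show ?thesis
    by (simp add: ennreal_mult_le_mult_iff)
qed

text \<open>
  Letting \<open>t\<close> decrease to \<open>s\<close> in the previous lemma, right continuity gives an inequality between
  the distribution functions, and the situation is symmetric in the two measures.
\<close>

lemma prob_on_nonneg_eqI_williamson:
  assumes \<mu>: "prob_on_nonneg \<mu>" and \<nu>: "prob_on_nonneg \<nu>" and "\<alpha> > 0"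
    and eq: "\<And>t. 0 < t \<Longrightarrow> williamson \<alpha> t \<mu> = williamson \<alpha> t \<nu>"
  shows "\<mu> = \<nu>"
proof -
  have rd: "real_distribution \<mu>" "real_distribution \<nu>"
    using \<mu> \<nu> by (auto simp: prob_on_nonneg_def real_distribution_def real_distribution_axioms_def)
  have le: "cdf \<mu>' s \<le> cdf \<nu>' s"
    if \<mu>': "prob_on_nonneg \<mu>'" and \<nu>': "prob_on_nonneg \<nu>'"
      and eq': "\<And>t. 0 < t \<Longrightarrow> williamson \<alpha> t \<mu>' = williamson \<alpha> t \<nu>'" for \<mu>' \<nu>' s
  proof -
    interpret m: prob_space \<mu>' using \<mu>' by (simp add: prob_on_nonneg_def)
    interpret n: real_distribution \<nu>'
      using \<nu>' by (auto simp: prob_on_nonneg_def real_distribution_def real_distribution_axioms_def)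
    show ?thesis
    proof (cases "s < 0")
      case True
      have "emeasure \<mu>' {..s} \<le> emeasure \<mu>' {..<0}"
        using True \<mu>' by (intro emeasure_mono) (auto simp: prob_on_nonneg_def)
      with \<mu>' have "cdf \<mu>' s = 0"
        by (simp add: prob_on_nonneg_def cdf_def measure_def)
      then show ?thesis by (simp add: cdf_def)
    next
      case False
      have "(cdf \<nu>' \<longlongrightarrow> cdf \<nu>' s) (at_right s)"
        using n.cdf_is_right_cont[of s] by (simp add: continuous_within)
      moreover have "cdf \<mu>' s \<le> cdf \<nu>' t" if "s < t" for t
        using emeasure_atMost_mono_of_williamson[OF \<mu>' \<nu>' \<open>\<alpha> > 0\<close> eq' _ that] False
        by (simp add: cdf_def m.emeasure_eq_measure n.emeasure_eq_measure)
      then have "eventually (\<lambda>t. cdf \<mu>' s \<le> cdf \<nu>' t) (at_right s)"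
        by (auto simp: eventually_at_filter)
      ultimately show ?thesis
        by (rule tendsto_lowerbound) simp
    qed
  qed
  have "cdf \<mu> = cdf \<nu>"
    using le[OF \<mu> \<nu> eq] le[OF \<nu> \<mu> eq[symmetric]] by (auto intro!: ext antisym)
  with rd show ?thesis by (rule cdf_unique)
qed

text \<open>
  With \<open>r = b / t < 1\<close> the integrand has the explicit primitive
  \<open>2 r\<^sup>\<alpha> x\<^sup>-\<^sup>\<alpha> - x\<^sup>-\<^sup>2\<^sup>\<alpha>\<close>, and only \<open>1 < x < 1 / r\<close> contributes. The index \<open>2\<alpha>\<close> of the Pareto law is
  exactly what makes the value a square.
\<close>

lemma williamson_scale_pareto:
  assumes "\<alpha> > 0" "0 < b" "0 < t"
  shows "williamson \<alpha> t (scale_law b (pareto (2 * \<alpha>))) = (ennreal (1 - (b / t) powr \<alpha>))\<^sup>2"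
proof -
  define r where "r = b / t"
  have r: "0 < r" using assms by (simp add: r_def)
  let ?d = "\<lambda>x. 2 * \<alpha> / x powr (2 * \<alpha> + 1)"
  have W: "williamson \<alpha> t (scale_law b (pareto (2 * \<alpha>))) =
      (\<integral>\<^sup>+x. ennreal (?d x * indicator {1<..} x) * ennreal (1 - (r * x) powr \<alpha>) \<partial>lborel)"
    by (simp add: williamson_def scale_law_def pareto_def nn_integral_distr nn_integral_density r_def
        mult.commute)
  show ?thesis
  proof (cases "r \<ge> 1")
    case True
    have "ennreal (?d x * indicator {1<..} x) * ennreal (1 - (r * x) powr \<alpha>) = 0" for x
    proof (cases "x > 1")
      case x: True
      have "1 * 1 \<le> r * x" using True x by (intro mult_mono) auto
      then have "1 \<le> (r * x) powr \<alpha>" using assms by (simp add: ge_one_powr_ge_zero)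
      then show ?thesis by (simp add: ennreal_neg)
    qed simp
    then have "williamson \<alpha> t (scale_law b (pareto (2 * \<alpha>))) = 0"
      unfolding W by (simp only: nn_integral_const mult_zero_left)
    then show ?thesis
      using True assms by (simp add: ennreal_neg ge_one_powr_ge_zero flip: r_def)
  next
    case False
    let ?u = "1 / r"
    let ?f = "\<lambda>x. ?d x * (1 - (r * x) powr \<alpha>)"
    let ?F = "\<lambda>x::real. 2 * r powr \<alpha> * x powr (- \<alpha>) - x powr (- (2 * \<alpha>))"
    have u: "1 \<le> ?u" using False r by simp
    have "williamson \<alpha> t (scale_law b (pareto (2 * \<alpha>))) =
        (\<integral>\<^sup>+x. ennreal (?f x) * indicator {1..?u} x \<partial>lborel)"
      unfolding W
    proof (rule nn_integral_cong_AE)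
      show "AE x in lborel. ennreal (?d x * indicator {1<..} x) * ennreal (1 - (r * x) powr \<alpha>) =
          ennreal (?f x) * indicator {1..?u} x"
        using AE_lborel_singleton[of "1 :: real"]
      proof eventually_elim
        case (elim x)
        consider "x < 1" | "1 < x" "x \<le> ?u" | "1 < x" "?u < x" using elim by linarith
        then show ?case
        proof cases
          case 2
          then have "r * x \<le> 1" using r by (simp add: field_simps)
          then show ?thesis using 2 assms by (simp flip: ennreal_mult')
        next
          case 3
          then have "1 \<le> r * x" using r by (simp add: field_simps)
          then have "1 \<le> (r * x) powr \<alpha>" using assms by (simp add: ge_one_powr_ge_zero)
          then show ?thesis using 3 by (simp add: ennreal_neg)
        qed simp
      qed
    qed
    also have "\<dots> = ennreal (?F ?u - ?F 1)"
    proof (rule nn_integral_FTC_Icc)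
      fix x :: real assume "x \<in> {1..?u}"
      then have x: "1 \<le> x" "x \<le> ?u" by auto
      have "(?F has_real_derivative
          2 * r powr \<alpha> * (- \<alpha> * x powr (- \<alpha> - 1)) - (- (2 * \<alpha>) * x powr (- (2 * \<alpha>) - 1))) (at x)"
        using x by (auto intro!: derivative_eq_intros)
      also have "2 * r powr \<alpha> * (- \<alpha> * x powr (- \<alpha> - 1)) - (- (2 * \<alpha>) * x powr (- (2 * \<alpha>) - 1)) = ?f x"
      proof -
        have "x powr (2 * \<alpha> + 1) = x powr \<alpha> * x powr \<alpha> * x" 
          using x powr_add[of x \<alpha> \<alpha>] by (simp add: powr_add)
        moreover have "x powr (- \<alpha> - 1) = 1 / (x powr \<alpha> * x)"
          using x by (simp add: powr_diff powr_minus field_simps)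
        moreover have "x powr (- (2 * \<alpha>) - 1) = 1 / (x powr \<alpha> * x powr \<alpha> * x)"
          using x powr_add[of x \<alpha> \<alpha>] by (simp add: powr_diff powr_minus field_simps)
        moreover have "(r * x) powr \<alpha> = r powr \<alpha> * x powr \<alpha>"
          using x r by (simp add: powr_mult)
        ultimately show ?thesis using x by (simp add: field_simps)
      qed
      finally show "(?F has_real_derivative ?f x) (at x)" .
      have "(r * x) powr \<alpha> \<le> 1"
        using x r assms by (intro powr_le1) (auto simp: field_simps)
      then show "0 \<le> ?f x" using assms by simp
    qed (use u in auto)
    also have "?F ?u - ?F 1 = (1 - r powr \<alpha>)\<^sup>2"
    proof -
      have "?u powr (- \<alpha>) = r powr \<alpha>" "?u powr (- (2 * \<alpha>)) = r powr \<alpha> * r powr \<alpha>"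
        using r by (simp_all add: powr_divide powr_minus field_simps flip: powr_add)
      then show ?thesis by (simp add: power2_eq_square algebra_simps)
    qed
    also have "ennreal ((1 - r powr \<alpha>)\<^sup>2) = (ennreal (1 - r powr \<alpha>))\<^sup>2"
      using False r assms by (intro ennreal_power[symmetric]) (simp add: powr_le1)
    finally show ?thesis by (simp add: r_def)
  qed
qed

lemma nn_integral_kendall_point:
  assumes "\<alpha> > 0" "0 \<le> a" "a \<le> b" "0 < b" and [measurable]: "f \<in> borel_measurable borel"
  shows "(\<integral>\<^sup>+x. f x \<partial>kendall_point \<alpha> a b) =
      ennreal (1 - a powr \<alpha> / b powr \<alpha>) * f b +
      ennreal (a powr \<alpha> / b powr \<alpha>) * (\<integral>\<^sup>+x. f x \<partial>scale_law b (pareto (2 * \<alpha>)))"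
proof -
  have p: "0 \<le> a powr \<alpha> / b powr \<alpha>" "a powr \<alpha> / b powr \<alpha> \<le> 1"
    using assms by (auto simp: divide_le_eq intro!: powr_mono2)
  define B where "B = (\<lambda>c. if c then scale_law b (pareto (2 * \<alpha>)) else return borel b)"
  have B: "B \<in> measurable (measure_pmf (bernoulli_pmf (a powr \<alpha> / b powr \<alpha>))) (subprob_algebra borel)"
    unfolding B_def by (intro measurable_prob_algebraD kendall_component_measurable assms)
  have "kendall_point \<alpha> a b = measure_pmf (bernoulli_pmf (a powr \<alpha> / b powr \<alpha>)) \<bind> B"
    using assms by (simp add: kendall_point_def B_def)
  then have "(\<integral>\<^sup>+x. f x \<partial>kendall_point \<alpha> a b) =
      (\<integral>\<^sup>+c. (\<integral>\<^sup>+x. f x \<partial>B c) \<partial>measure_pmf (bernoulli_pmf (a powr \<alpha> / b powr \<alpha>)))"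
    by (simp add: nn_integral_bind[OF assms(5) B])
  then show ?thesis
    using p by (simp add: B_def nn_integral_return mult.commute add.commute)
qed

text \<open>
  The transform is multiplicative on point masses: with \<open>p = (a / b)\<^sup>\<alpha>\<close> and \<open>q = (b / t)\<^sup>\<alpha>\<close>
  the mixture gives \<open>(1 - p) (1 - q) + p (1 - q)\<^sup>2 = (1 - p q) (1 - q)\<close>, and \<open>p q = (a / t)\<^sup>\<alpha>\<close>.
\<close>

lemma williamson_kendall_point:
  assumes "\<alpha> > 0" "0 \<le> x" "0 \<le> y" "0 < t"
  shows "williamson \<alpha> t (kendall_point \<alpha> x y) = ennreal (1 - (x / t) powr \<alpha>) * ennreal (1 - (y / t) powr \<alpha>)"
proof -
  have ordered: "williamson \<alpha> t (kendall_point \<alpha> a b) = ennreal (1 - (a / t) powr \<alpha>) * ennreal (1 - (b / t) powr \<alpha>)"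
    if ab: "0 \<le> a" "a \<le> b" for a b
  proof (cases "b = 0")
    case True
    with ab show ?thesis
      using assms by (simp add: kendall_point_zero williamson_def nn_integral_return)
  next
    case False
    with ab have b: "0 < b" by simp
    define p where "p = a powr \<alpha> / b powr \<alpha>"
    define q where "q = (b / t) powr \<alpha>"
    have p: "0 \<le> p" "p \<le> 1"
      using assms ab b by (auto simp: p_def divide_le_eq intro!: powr_mono2)
    have pq: "(a / t) powr \<alpha> = p * q"
      using ab b assms by (simp add: p_def q_def powr_divide)
    have "williamson \<alpha> t (kendall_point \<alpha> a b) =
        ennreal (1 - p) * ennreal (1 - q) + ennreal p * (ennreal (1 - q))\<^sup>2"
      using ab b assms williamson_scale_pareto[of \<alpha> b t]
      by (simp add: williamson_def nn_integral_kendall_point p_def q_def)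
    also have "\<dots> = ennreal (1 - p * q) * ennreal (1 - q)"
    proof (cases "q \<le> 1")
      case True
      have q: "0 \<le> q" by (simp add: q_def)
      have "p * q \<le> 1" using p True q by (simp add: mult_le_one)
      have "ennreal (1 - p) * ennreal (1 - q) + ennreal p * (ennreal (1 - q))\<^sup>2 =
          ennreal ((1 - p) * (1 - q) + p * (1 - q)\<^sup>2)"
        using p True by (simp add: ennreal_mult ennreal_power)
      also have "(1 - p) * (1 - q) + p * (1 - q)\<^sup>2 = (1 - p * q) * (1 - q)"
        by (simp add: power2_eq_square algebra_simps)
      finally show ?thesis using \<open>p * q \<le> 1\<close> True by (simp add: ennreal_mult)
    qed (simp add: ennreal_neg)
    finally show ?thesis by (simp add: pq q_def)
  qed
  show ?thesis
  proof (cases "x \<le> y")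
    case True
    with ordered assms show ?thesis by simp
  next
    case False
    with ordered[of y x] assms show ?thesis by (simp add: kendall_point_commute[of \<alpha> x y] mult.commute)
  qed
qed

section \<open>The Kendall convolution semigroup\<close>

text \<open>
  Convolving with a point mass on the left defines a Markov kernel, and every convolution
  is an average over this kernel. This is the form in which the convolution enters the
  transition probabilities of the random walk.
\<close>

lemma kendall_conv_return:
  assumes "\<alpha> > 0" "prob_on_nonneg \<mu>"
  shows "kendall_conv \<alpha> (return borel x) \<mu> = \<mu> \<bind> kendall_point \<alpha> x"
proof -
  note kendall_point_measurable[OF assms(1), measurable]
  have [measurable]: "(\<lambda>_. \<mu>) \<in> measurable borel (prob_algebra borel)"
    using assms by (auto simp: space_prob_algebra prob_on_nonneg_def)
  have "(\<lambda>x. \<mu> \<bind> kendall_point \<alpha> x) \<in> measurable borel (prob_algebra borel)"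
    by measurable
  from bind_return[OF measurable_prob_algebraD[OF this], of x] show ?thesis
    by (simp add: kendall_conv_def)
qed

lemma measurable_kendall_kernel:
  assumes "\<alpha> > 0" "prob_on_nonneg \<mu>"
  shows "(\<lambda>x. kendall_conv \<alpha> (return borel x) \<mu>) \<in> measurable borel (prob_algebra borel)"
proof -
  note kendall_point_measurable[OF assms(1), measurable]
  have [measurable]: "(\<lambda>_. \<mu>) \<in> measurable borel (prob_algebra borel)"
    using assms by (auto simp: space_prob_algebra prob_on_nonneg_def)
  show ?thesis
    unfolding kendall_conv_return[OF assms] by measurable
qed

lemma kendall_conv_eq_bind_kernel:
  assumes "\<alpha> > 0" "prob_on_nonneg \<mu>"
  shows "kendall_conv \<alpha> \<kappa> \<mu> = \<kappa> \<bind> (\<lambda>x. kendall_conv \<alpha> (return borel x) \<mu>)"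
  unfolding kendall_conv_return[OF assms] by (simp add: kendall_conv_def)

lemma nn_integral_kendall_conv_kernel:
  assumes "\<alpha> > 0" "prob_on_nonneg \<kappa>" "prob_on_nonneg \<mu>" "f \<in> borel_measurable borel"
  shows "(\<integral>\<^sup>+z. f z \<partial>kendall_conv \<alpha> \<kappa> \<mu>) =
      (\<integral>\<^sup>+x. (\<integral>\<^sup>+z. f z \<partial>kendall_conv \<alpha> (return borel x) \<mu>) \<partial>\<kappa>)"
proof -
  have [measurable_cong]: "sets \<kappa> = sets borel"
    using assms by (simp add: prob_on_nonneg_def)
  note measurable_kendall_kernel[OF assms(1,3), measurable]
  show ?thesis
    unfolding kendall_conv_eq_bind_kernel[OF assms(1,3), of \<kappa>]
    by (intro nn_integral_bind[OF assms(4)] measurable_prob_algebraD) measurable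
qed

lemma nn_integral_kendall_kernel:
  assumes "\<alpha> > 0" "prob_on_nonneg \<mu>" "f \<in> borel_measurable borel"
  shows "(\<integral>\<^sup>+z. f z \<partial>kendall_conv \<alpha> (return borel x) \<mu>) =
      (\<integral>\<^sup>+y. (\<integral>\<^sup>+z. f z \<partial>kendall_point \<alpha> x y) \<partial>\<mu>)"
proof -
  have [measurable_cong]: "sets \<mu> = sets borel"
    using assms by (simp add: prob_on_nonneg_def)
  note kendall_point_measurable[OF assms(1), measurable]
  show ?thesis
    unfolding kendall_conv_return[OF assms(1,2)]
    by (intro nn_integral_bind[OF assms(3)] measurable_prob_algebraD) measurable
qed

lemma kendall_point_nonneg:
  assumes "\<alpha> > 0" "0 \<le> x" "0 \<le> y"
  shows "emeasure (kendall_point \<alpha> x y) {..<0} = 0"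
proof -
  have pareto: "emeasure (scale_law b (pareto (2 * \<alpha>))) {..<0} = 0" if "0 < b" for b
  proof -
    have "emeasure (scale_law b (pareto (2 * \<alpha>))) {..<0} =
        (\<integral>\<^sup>+x. indicator {..<0} x \<partial>scale_law b (pareto (2 * \<alpha>)))"
      by (simp add: scale_law_def)
    also have "\<dots> = (\<integral>\<^sup>+x. ennreal (2 * \<alpha> / x powr (2 * \<alpha> + 1) * indicator {1<..} x) * indicator {..<0} (b * x) \<partial>lborel)"
      by (simp add: scale_law_def pareto_def nn_integral_distr nn_integral_density del: nn_integral_indicator)
    also have "\<dots> = (\<integral>\<^sup>+x. 0 \<partial>(lborel :: real measure))"
      using that by (intro nn_integral_cong) (auto simp: mult_less_0_iff split: split_indicator)
    finally show ?thesis by simp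
  qed
  have "emeasure (kendall_point \<alpha> a b) {..<0} = 0" if "0 \<le> a" "a \<le> b" for a b
  proof (cases "b = 0")
    case True
    with that show ?thesis by (simp add: kendall_point_zero)
  next
    case False
    with that assms pareto[of b] show ?thesis
      by (simp add: kendall_point_mixture)
  qed
  from this[of x y] this[of y x] show ?thesis
    using assms by (cases "x \<le> y") (auto simp: kendall_point_commute[of \<alpha> y x])
qed

lemma prob_on_nonneg_kendall_conv:
  assumes "\<alpha> > 0" "prob_on_nonneg \<kappa>" "prob_on_nonneg \<mu>"
  shows "prob_on_nonneg (kendall_conv \<alpha> \<kappa> \<mu>)"
  unfolding prob_on_nonneg_def
proof (intro conjI)
  have \<kappa>: "\<kappa> \<in> space (prob_algebra borel)"
    using assms by (auto simp: prob_on_nonneg_def space_prob_algebra)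
  then have "kendall_conv \<alpha> \<kappa> \<mu> \<in> space (prob_algebra borel)"
    unfolding kendall_conv_eq_bind_kernel[OF assms(1,3), of \<kappa>]
    using measurable_kendall_kernel[OF assms(1,3)]
    by (auto simp: space_prob_algebra intro!: prob_space_bind' sets_bind')
  then show "prob_space (kendall_conv \<alpha> \<kappa> \<mu>)" "sets (kendall_conv \<alpha> \<kappa> \<mu>) = sets borel"
    by (auto simp: space_prob_algebra)
  have "emeasure (kendall_conv \<alpha> \<kappa> \<mu>) {..<0} =
      (\<integral>\<^sup>+x. (\<integral>\<^sup>+y. emeasure (kendall_point \<alpha> x y) {..<0} \<partial>\<mu>) \<partial>\<kappa>)"
    using assms by (intro emeasure_kendall_conv) (auto simp: prob_on_nonneg_def)
  also have "\<dots> = (\<integral>\<^sup>+x. 0 \<partial>\<kappa>)"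
  proof (rule nn_integral_cong_AE)
    show "AE x in \<kappa>. (\<integral>\<^sup>+y. emeasure (kendall_point \<alpha> x y) {..<0} \<partial>\<mu>) = 0"
      using AE_nonneg_prob_on_nonneg[OF assms(2)]
    proof eventually_elim
      case (elim x)
      have "(\<integral>\<^sup>+y. emeasure (kendall_point \<alpha> x y) {..<0} \<partial>\<mu>) = (\<integral>\<^sup>+y. 0 \<partial>\<mu>)"
      proof (rule nn_integral_cong_AE)
        show "AE y in \<mu>. emeasure (kendall_point \<alpha> x y) {..<0} = 0"
          using AE_nonneg_prob_on_nonneg[OF assms(3)]
          by eventually_elim (simp add: kendall_point_nonneg assms elim)
      qed
      then show ?case by simp
    qed
  qed
  finally show "emeasure (kendall_conv \<alpha> \<kappa> \<mu>) {..<0} = 0" by simp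
qed

lemma prob_on_nonneg_kendall_power:
  assumes "\<alpha> > 0" "prob_on_nonneg \<nu>"
  shows "prob_on_nonneg (kendall_power \<alpha> \<nu> n)"
  by (induction n) (auto simp: assms prob_on_nonneg_return prob_on_nonneg_kendall_conv)

lemma williamson_kendall_conv:
  assumes "\<alpha> > 0" "prob_on_nonneg \<kappa>" "prob_on_nonneg \<mu>" "0 < t"
  shows "williamson \<alpha> t (kendall_conv \<alpha> \<kappa> \<mu>) = williamson \<alpha> t \<kappa> * williamson \<alpha> t \<mu>"
proof -
  let ?h = "\<lambda>x. ennreal (1 - (x / t) powr \<alpha>)"
  have [measurable_cong]: "sets \<kappa> = sets borel" "sets \<mu> = sets borel"
    using assms by (auto simp: prob_on_nonneg_def)
  have "williamson \<alpha> t (kendall_conv \<alpha> \<kappa> \<mu>) = (\<integral>\<^sup>+x. (\<integral>\<^sup>+z. ?h z \<partial>kendall_conv \<alpha> (return borel x) \<mu>) \<partial>\<kappa>)"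
    unfolding williamson_def using assms by (intro nn_integral_kendall_conv_kernel) auto
  also have "\<dots> = (\<integral>\<^sup>+x. ?h x * williamson \<alpha> t \<mu> \<partial>\<kappa>)"
  proof (rule nn_integral_cong_AE)
    show "AE x in \<kappa>. (\<integral>\<^sup>+z. ?h z \<partial>kendall_conv \<alpha> (return borel x) \<mu>) = ?h x * williamson \<alpha> t \<mu>"
      using AE_nonneg_prob_on_nonneg[OF assms(2)]
    proof eventually_elim
      case (elim x)
      have "(\<integral>\<^sup>+z. ?h z \<partial>kendall_conv \<alpha> (return borel x) \<mu>) =
          (\<integral>\<^sup>+y. williamson \<alpha> t (kendall_point \<alpha> x y) \<partial>\<mu>)"
        unfolding williamson_def using assms by (intro nn_integral_kendall_kernel) auto
      also have "\<dots> = (\<integral>\<^sup>+y. ?h x * ?h y \<partial>\<mu>)"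
        using AE_nonneg_prob_on_nonneg[OF assms(3)]
        by (intro nn_integral_cong_AE) (auto simp: williamson_kendall_point assms elim)
      also have "\<dots> = ?h x * williamson \<alpha> t \<mu>"
        unfolding williamson_def by (rule nn_integral_cmult) simp
      finally show ?case .
    qed
  qed
  also have "\<dots> = williamson \<alpha> t \<kappa> * williamson \<alpha> t \<mu>"
    unfolding williamson_def by (rule nn_integral_multc) simp
  finally show ?thesis .
qed

text \<open>
  Multiplication of transforms is associative and transforms determine measures. The same
  argument shows that the point mass at \<open>0\<close>, whose transform is \<open>1\<close>, is neutral.
\<close>

lemma kendall_conv_assoc:
  assumes "\<alpha> > 0" "prob_on_nonneg \<mu>1" "prob_on_nonneg \<mu>2" "prob_on_nonneg \<mu>3"
  shows "kendall_conv \<alpha> (kendall_conv \<alpha> \<mu>1 \<mu>2) \<mu>3 = kendall_conv \<alpha> \<mu>1 (kendall_conv \<alpha> \<mu>2 \<mu>3)"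
  using assms
  by (intro prob_on_nonneg_eqI_williamson[of _ _ \<alpha>])
     (auto simp: prob_on_nonneg_kendall_conv williamson_kendall_conv mult.assoc)

lemma williamson_return_zero: "williamson \<alpha> t (return borel 0) = 1"
  by (simp add: williamson_def nn_integral_return)

lemma kendall_conv_zero_right:
  assumes "\<alpha> > 0" "prob_on_nonneg \<mu>"
  shows "kendall_conv \<alpha> \<mu> (return borel 0) = \<mu>"
  using assms
  by (intro prob_on_nonneg_eqI_williamson[of _ _ \<alpha>])
     (auto simp: prob_on_nonneg_kendall_conv prob_on_nonneg_return williamson_kendall_conv williamson_return_zero)

lemma kendall_conv_zero_left:
  assumes "\<alpha> > 0" "prob_on_nonneg \<mu>"
  shows "kendall_conv \<alpha> (return borel 0) \<mu> = \<mu>"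
  using assms
  by (intro prob_on_nonneg_eqI_williamson[of _ _ \<alpha>])
     (auto simp: prob_on_nonneg_kendall_conv prob_on_nonneg_return williamson_kendall_conv williamson_return_zero)

section \<open>Fresh coordinates, conditional probabilities and independence\<close>

text \<open>
  Replacing one coordinate of a product measure by an independent copy does not change the
  law. Independence of that coordinate from everything that ignores it is obtained from this
  by integration, without splitting the index set.
\<close>

lemma (in product_prob_space) distr_PiM_fun_upd:
  assumes i: "i \<in> I"
  shows "distr (PiM I M \<Otimes>\<^sub>M M i) (PiM I M) (\<lambda>(\<omega>, w). fun_upd \<omega> i w) = PiM I M"
proof (rule PiM_eq)
  have [measurable]: "(\<lambda>(\<omega>, w). fun_upd \<omega> i w) \<in> measurable (PiM I M \<Otimes>\<^sub>M M i) (PiM I M)"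
    unfolding split_beta' using i by (intro measurable_fun_upd[where J=I]) auto
  fix J F assume J: "finite J" "J \<subseteq> I" and F: "\<And>j. j \<in> J \<Longrightarrow> F j \<in> sets (M j)"
  let ?emb = "prod_emb I M (J - {i}) (Pi\<^sub>E (J - {i}) F)"
  let ?Fi = "if i \<in> J then F i else space (M i)"
  have Fi: "?Fi \<in> sets (M i)" using F by auto
  have emb: "?emb \<in> sets (PiM I M)" using J F by (intro sets_PiM_I) auto
  have emb_eq: "prod_emb I M K (Pi\<^sub>E K F) = {\<omega>\<in>space (PiM I M). \<forall>j\<in>K. \<omega> j \<in> F j}" if "K \<subseteq> I" for K
    using that unfolding prod_emb_def by (auto simp: space_PiM Pi_iff)
  have upd: "fun_upd \<omega> i w \<in> space (PiM I M)" if "\<omega> \<in> space (PiM I M)" "w \<in> space (M i)" for \<omega> w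
    using that i by (auto simp: space_PiM PiE_iff extensional_def)
  have J': "J - {i} \<subseteq> I" using J by auto
  have "(\<lambda>(\<omega>, w). fun_upd \<omega> i w) -` prod_emb I M J (Pi\<^sub>E J F) \<inter> space (PiM I M \<Otimes>\<^sub>M M i) = ?emb \<times> ?Fi"
    (is "?L = ?R")
  proof (intro set_eqI)
    fix p :: "('i \<Rightarrow> 'a) \<times> 'a"
    obtain \<omega> w where p: "p = (\<omega>, w)" by (cases p)
    have "p \<in> ?L \<longleftrightarrow> \<omega> \<in> space (PiM I M) \<and> w \<in> space (M i) \<and> (\<forall>j\<in>J. fun_upd \<omega> i w j \<in> F j)"
      using upd[of \<omega> w] unfolding emb_eq[OF J(2)] p by (auto simp: space_pair_measure)
    also have "(\<forall>j\<in>J. fun_upd \<omega> i w j \<in> F j) \<longleftrightarrow> (\<forall>j\<in>J - {i}. \<omega> j \<in> F j) \<and> (i \<in> J \<longrightarrow> w \<in> F i)"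
      by auto
    also have "\<omega> \<in> space (PiM I M) \<and> w \<in> space (M i) \<and> \<dots> \<longleftrightarrow> p \<in> ?R"
      using F[of i, THEN sets.sets_into_space] unfolding emb_eq[OF J'] p by auto
    finally show "p \<in> ?L \<longleftrightarrow> p \<in> ?R" .
  qed
  then have "emeasure (distr (PiM I M \<Otimes>\<^sub>M M i) (PiM I M) (\<lambda>(\<omega>, w). fun_upd \<omega> i w)) (prod_emb I M J (Pi\<^sub>E J F)) =
      emeasure (PiM I M \<Otimes>\<^sub>M M i) (?emb \<times> ?Fi)"
    using J F by (subst emeasure_distr) (auto intro!: sets_PiM_I)
  also have "\<dots> = emeasure (PiM I M) ?emb * emeasure (M i) ?Fi"
    using emb Fi by (rule M.emeasure_pair_measure_Times)
  also have "emeasure (PiM I M) ?emb = (\<Prod>j\<in>J - {i}. emeasure (M j) (F j))"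
    using J F by (intro emeasure_PiM_emb) auto
  also have "(\<Prod>j\<in>J - {i}. emeasure (M j) (F j)) * emeasure (M i) ?Fi = (\<Prod>j\<in>J. emeasure (M j) (F j))"
    using J prod.remove[of J i "\<lambda>j. emeasure (M j) (F j)"]
    by (cases "i \<in> J") (simp_all add: M.emeasure_space_1 mult.commute)
  finally show "emeasure (distr (PiM I M \<Otimes>\<^sub>M M i) (PiM I M) (\<lambda>(\<omega>, w). fun_upd \<omega> i w)) (prod_emb I M J (Pi\<^sub>E J F)) =
      (\<Prod>j\<in>J. emeasure (M j) (F j))" .
qed (rule sets_distr)

lemma (in product_prob_space) nn_integral_PiM_fresh_coordinate:
  assumes i: "i \<in> I"
    and F [measurable]: "F \<in> measurable (PiM I M) N"
    and fresh: "\<And>\<omega> w. \<omega> \<in> space (PiM I M) \<Longrightarrow> w \<in> space (M i) \<Longrightarrow> F (fun_upd \<omega> i w) = F \<omega>"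
    and h [measurable]: "h \<in> borel_measurable (N \<Otimes>\<^sub>M M i)"
  shows "(\<integral>\<^sup>+\<omega>. h (F \<omega>, \<omega> i) \<partial>PiM I M) = (\<integral>\<^sup>+\<omega>. (\<integral>\<^sup>+w. h (F \<omega>, w) \<partial>M i) \<partial>PiM I M)"
proof -
  let ?u = "\<lambda>(\<omega>, w). fun_upd \<omega> i w"
  note measurable_component_singleton[OF i, measurable]
  have u: "?u \<in> measurable (PiM I M \<Otimes>\<^sub>M M i) (PiM I M)"
    unfolding split_beta' using i by (intro measurable_fun_upd[where J=I]) auto
  have H: "(\<lambda>\<omega>. h (F \<omega>, \<omega> i)) \<in> borel_measurable (PiM I M)"
    by measurable
  have hF: "(\<lambda>p. h (F (fst p), snd p)) \<in> borel_measurable (PiM I M \<Otimes>\<^sub>M M i)"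
    by measurable
  have "(\<integral>\<^sup>+\<omega>. h (F \<omega>, \<omega> i) \<partial>PiM I M) =
      (\<integral>\<^sup>+\<omega>. h (F \<omega>, \<omega> i) \<partial>distr (PiM I M \<Otimes>\<^sub>M M i) (PiM I M) ?u)"
    unfolding distr_PiM_fun_upd[OF i] ..
  also have "\<dots> = (\<integral>\<^sup>+p. h (F (?u p), ?u p i) \<partial>(PiM I M \<Otimes>\<^sub>M M i))"
    using H by (intro nn_integral_distr[OF u]) simp
  also have "\<dots> = (\<integral>\<^sup>+p. h (F (fst p), snd p) \<partial>(PiM I M \<Otimes>\<^sub>M M i))"
  proof (rule nn_integral_cong)
    fix p assume "p \<in> space (PiM I M \<Otimes>\<^sub>M M i)"
    then show "h (F (?u p), ?u p i) = h (F (fst p), snd p)"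
      by (auto simp: space_pair_measure fresh)
  qed
  also have "\<dots> = (\<integral>\<^sup>+\<omega>. (\<integral>\<^sup>+w. h (F \<omega>, w) \<partial>M i) \<partial>PiM I M)"
    using M.nn_integral_fst[OF hF] by simp
  finally show ?thesis .
qed

lemma finite_measure_subalgebra_vimage:
  assumes "prob_space M" "Y \<in> measurable M N"
  shows "finite_measure_subalgebra M (vimage_algebra (space M) Y N)"
proof -
  interpret prob_space M by fact
  have "subalgebra M (vimage_algebra (space M) Y N)"
    unfolding subalgebra_def using sets_image_in_sets[OF refl assms(2)] by simp
  then show ?thesis
    by unfold_locales
qed

lemma set_integral_indicator_eq_measure:
  assumes "A \<in> sets M"
  shows "(\<integral>x\<in>A. indicator E x \<partial>M) = measure M (A \<inter> E)"
proof -
  have "(\<integral>x\<in>A. indicator E x \<partial>M) = (\<integral>x. indicator (A \<inter> E) x \<partial>M :: real)"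
    unfolding set_lebesgue_integral_def
    by (intro Bochner_Integration.integral_cong) (auto split: split_indicator)
  moreover have "A \<inter> E \<inter> space M = A \<inter> E"
    using sets.sets_into_space[OF assms] by blast
  ultimately show ?thesis by simp
qed

text \<open>
  A conditional probability is identified by its integrals over the events \<open>Y \<in> B\<close>, which
  form the conditioning \<open>\<sigma>\<close>-algebra. The converse direction follows below.
\<close>

lemma cond_prob_given_eqI:
  assumes M: "prob_space M" and Y [measurable]: "Y \<in> measurable M N" and E [measurable]: "E \<in> sets M"
    and g [measurable]: "g \<in> borel_measurable N"
    and bounds: "\<And>\<omega>. \<omega> \<in> space M \<Longrightarrow> 0 \<le> g (Y \<omega>) \<and> g (Y \<omega>) \<le> 1"
    and eq: "\<And>B. B \<in> sets N \<Longrightarrow>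
      emeasure M (Y -` B \<inter> space M \<inter> E) = (\<integral>\<^sup>+\<omega>. ennreal (g (Y \<omega>)) * indicator B (Y \<omega>) \<partial>M)"
  shows "AE \<omega> in M. cond_prob_given M E N Y \<omega> = g (Y \<omega>)"
proof -
  let ?F = "vimage_algebra (space M) Y N"
  interpret finite_measure_subalgebra M ?F
    using M Y by (rule finite_measure_subalgebra_vimage)
  have Yspace: "Y \<in> space M \<rightarrow> space N" using measurable_space[OF Y] by auto
  have int: "integrable M (\<lambda>\<omega>. g (Y \<omega>))"
    using bounds by (intro integrable_const_bound[where B=1] AE_I2) simp_all
  show ?thesis
    unfolding cond_prob_given_def
  proof (rule real_cond_exp_charact)
    fix A assume "A \<in> sets ?F"
    then obtain B where B [measurable]: "B \<in> sets N" and A: "A = Y -` B \<inter> space M"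
      using Yspace by (auto simp: sets_vimage_algebra2)
    have [measurable]: "A \<in> sets M" unfolding A by measurable
    have "(\<integral>x\<in>A. indicator E x \<partial>M) = measure M (A \<inter> E)"
      by (simp add: set_integral_indicator_eq_measure)
    also have "\<dots> = enn2real (\<integral>\<^sup>+\<omega>. ennreal (g (Y \<omega>)) * indicator B (Y \<omega>) \<partial>M)"
      unfolding A measure_def by (simp add: eq[OF B])
    also have "(\<integral>\<^sup>+\<omega>. ennreal (g (Y \<omega>)) * indicator B (Y \<omega>) \<partial>M) =
        (\<integral>\<^sup>+\<omega>. ennreal (indicator A \<omega> * g (Y \<omega>)) \<partial>M)"
      by (intro nn_integral_cong) (auto simp: A split: split_indicator)
    also have "enn2real \<dots> = (\<integral>x\<in>A. g (Y x) \<partial>M)"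
      unfolding set_lebesgue_integral_def
      using bounds by (intro trans[OF _ integral_eq_nn_integral[symmetric]] AE_I2) (auto simp: indicator_def)
    finally show "(\<integral>x\<in>A. indicator E x \<partial>M) = (\<integral>x\<in>A. g (Y x) \<partial>M)" .
  next
    show "(\<lambda>\<omega>. g (Y \<omega>)) \<in> borel_measurable ?F"
      using Yspace by (intro measurable_compose[OF measurable_vimage_algebra1 g])
      show "integrable M (indicator E :: _ \<Rightarrow> real)"
      by (intro integrable_const_bound[where B=1] AE_I2) (simp_all add: indicator_def)
  qed (rule int)
qed

lemma emeasure_Int_of_cond_prob_given:
  assumes M: "prob_space M" and Y [measurable]: "Y \<in> measurable M N" and E [measurable]: "E \<in> sets M"
    and g [measurable]: "g \<in> borel_measurable N" and nonneg: "\<And>y. 0 \<le> g y"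
    and cond: "AE \<omega> in M. cond_prob_given M E N Y \<omega> = g (Y \<omega>)"
    and B [measurable]: "B \<in> sets N"
  shows "emeasure M (Y -` B \<inter> space M \<inter> E) = (\<integral>\<^sup>+\<omega>. ennreal (g (Y \<omega>)) * indicator B (Y \<omega>) \<partial>M)"
proof -
  let ?F = "vimage_algebra (space M) Y N"
  define A where "A = Y -` B \<inter> space M"
  interpret finite_measure_subalgebra M ?F
    using M Y by (rule finite_measure_subalgebra_vimage)
  have [measurable]: "A \<in> sets M" unfolding A_def by measurable
  have AF: "A \<in> sets ?F" unfolding A_def by (rule in_vimage_algebra) fact
  have intE: "integrable M (indicator E :: _ \<Rightarrow> real)"
    by (intro integrable_const_bound[where B=1] AE_I2) (simp_all add: indicator_def)
  have int: "integrable M (\<lambda>\<omega>. g (Y \<omega>))"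
    using integrable_cong_AE_imp[OF real_cond_exp_int(1)[OF intE], of "\<lambda>\<omega>. g (Y \<omega>)"] cond
    unfolding cond_prob_given_def by (simp add: eq_commute)
  have "measure M (A \<inter> E) = (\<integral>x\<in>A. indicator E x \<partial>M)"
      by (simp add: set_integral_indicator_eq_measure)
  also have "\<dots> = (\<integral>x\<in>A. cond_prob_given M E N Y x \<partial>M)"
    unfolding cond_prob_given_def by (rule real_cond_exp_intA[OF intE AF])
  also have "\<dots> = (\<integral>x\<in>A. g (Y x) \<partial>M)"
    using cond unfolding set_lebesgue_integral_def cond_prob_given_def
    by (intro integral_cong_AE) (auto elim: eventually_mono)
  also have "\<dots> = (\<integral>x. g (Y x) * indicator B (Y x) \<partial>M)"
    unfolding set_lebesgue_integral_def
    by (intro Bochner_Integration.integral_cong) (auto simp: A_def split: split_indicator)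
  finally have "emeasure M (A \<inter> E) = ennreal (\<integral>x. g (Y x) * indicator B (Y x) \<partial>M)"
    by (simp add: emeasure_eq_measure)
  also have "\<dots> = (\<integral>\<^sup>+x. ennreal (g (Y x) * indicator B (Y x)) \<partial>M)"
  proof (rule nn_integral_eq_integral[symmetric])
    have "integrable M (\<lambda>x. g (Y x) * indicator A x)"
      by (rule integrable_real_mult_indicator[OF _ int]) fact
    also have "?this \<longleftrightarrow> integrable M (\<lambda>x. g (Y x) * indicator B (Y x))"
      by (intro Bochner_Integration.integrable_cong) (auto simp: A_def split: split_indicator)
    finally show "integrable M (\<lambda>x. g (Y x) * indicator B (Y x))" .
  qed (intro AE_I2 mult_nonneg_nonneg nonneg indicator_pos_le)
  finally show ?thesis
    by (simp only: A_def ennreal_mult'[OF nonneg] ennreal_indicator)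
qed

lemma indep_rvI:
  assumes "prob_space M" and [measurable]: "X \<in> measurable M S" "Y \<in> measurable M T"
    and "\<And>A B. A \<in> sets S \<Longrightarrow> B \<in> sets T \<Longrightarrow>
      emeasure M {\<omega>\<in>space M. X \<omega> \<in> A \<and> Y \<omega> \<in> B} =
      emeasure M {\<omega>\<in>space M. X \<omega> \<in> A} * emeasure M {\<omega>\<in>space M. Y \<omega> \<in> B}"
  shows "indep_rv M S X T Y"
proof -
  interpret prob_space M by fact
  have "prob (X -` A \<inter> space M \<inter> (Y -` B \<inter> space M)) = prob (X -` A \<inter> space M) * prob (Y -` B \<inter> space M)"
    if "A \<in> sets S" "B \<in> sets T" for A B
  proof -
    have "X -` A \<inter> space M \<inter> (Y -` B \<inter> space M) = {\<omega>\<in>space M. X \<omega> \<in> A \<and> Y \<omega> \<in> B}"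
      "X -` A \<inter> space M = {\<omega>\<in>space M. X \<omega> \<in> A}" "Y -` B \<inter> space M = {\<omega>\<in>space M. Y \<omega> \<in> B}"
      by auto
    with assms(4)[OF that] show ?thesis
      by (simp only: emeasure_eq_measure ennreal_mult[symmetric] measure_nonneg ennreal_inj mult_nonneg_nonneg)
  qed
  then have "indep_set {X -` A \<inter> space M |A. A \<in> sets S} {Y -` B \<inter> space M |B. B \<in> sets T}"
    by (intro indep_setI) auto
  then show ?thesis
    using assms(2,3) unfolding indep_rv_def by (intro conjI)
qed

text \<open>
  \<open>indep_var\<close> speaks about the generated \<open>\<sigma>\<close>-algebras, but the preimages of the sets of a
  \<open>\<sigma>\<close>-algebra already form one.
\<close>

lemma indep_var_of_indep_rv:
  assumes "prob_space M" "indep_rv M S X T Y"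
  shows "prob_space.indep_var M S X T Y"
proof -
  interpret prob_space M by fact
  have [measurable]: "X \<in> measurable M S" "Y \<in> measurable M T"
    using assms(2) by (simp_all add: indep_rv_def)
  have sigma: "sigma_sets (space M) {f -` A \<inter> space M | A. A \<in> sets N} = {f -` A \<inter> space M | A. A \<in> sets N}"
    if "f \<in> measurable M N" for f :: "'a \<Rightarrow> 'b" and N
  proof -
    have "f \<in> space M \<rightarrow> space N" using measurable_space[OF that] by auto
    from sets_vimage_algebra2[OF this] show ?thesis
      unfolding sets_vimage_algebra .
  qed
  note s1 = sigma[OF \<open>X \<in> measurable M S\<close>] 
  note s2 = sigma[OF \<open>Y \<in> measurable M T\<close>] 
  have "indep_set {X -` A \<inter> space M |A. A \<in> sets S} {Y -` B \<inter> space M |B. B \<in> sets T}"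
   using assms(2) unfolding indep_rv_def by (elim conjE)
  then have "indep_set (sigma_sets (space M) {X -` A \<inter> space M |A. A \<in> sets S}) (sigma_sets (space M) {Y -` B \<inter> space M |B. B \<in> sets T})"
   by (simp only: s1 s2)
  then show ?thesis
    unfolding indep_var_eq using \<open>X \<in> measurable M S\<close> \<open>Y \<in> measurable M T\<close> by simp
qed

lemma indep_rv_compose:
  assumes "prob_space M" "indep_rv M S X T Y" "f \<in> measurable T T'"
  shows "indep_rv M S X T' (\<lambda>\<omega>. f (Y \<omega>))"
proof -
  interpret prob_space M by fact
  have XY [measurable]: "X \<in> measurable M S" "Y \<in> measurable M T"
    using assms(2) by (auto simp: indep_rv_def)
  note assms(3) [measurable]
  have sub: "{(\<lambda>\<omega>. f (Y \<omega>)) -` B \<inter> space M |B. B \<in> sets T'} \<subseteq> {Y -` B \<inter> space M |B. B \<in> sets T}"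
  proof safe
    fix B assume "B \<in> sets T'"
    then have "f -` B \<inter> space T \<in> sets T" by measurable
    moreover have "(\<lambda>\<omega>. f (Y \<omega>)) -` B \<inter> space M = Y -` (f -` B \<inter> space T) \<inter> space M"
      using measurable_space[OF XY(2)] by auto
    ultimately show "\<exists>B'. (\<lambda>\<omega>. f (Y \<omega>)) -` B \<inter> space M = Y -` B' \<inter> space M \<and> B' \<in> sets T" by blast
  qed
  have mono: "indep_set G H'" if "indep_set G H" "H' \<subseteq> H" for G H H'
    using that unfolding indep_sets2_eq by blast
  show ?thesis
    using assms(2) mono[OF _ sub] unfolding indep_rv_def by simp
qed

section \<open>Uniqueness of the Kendall random walk in law\<close>

lemma measurable_past:
  assumes "\<And>n. X n \<in> borel_measurable M"
  shows "(\<lambda>\<omega>. \<lambda>i\<in>{..k::nat}. X i \<omega>) \<in> measurable M (\<Pi>\<^sub>M i\<in>{..k}. borel)"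
  using assms by (intro measurable_restrict) auto

lemma measure_kendall_kernel_bounds:
  assumes "\<alpha> > 0" "prob_on_nonneg \<mu>"
  shows "(\<lambda>x. measure (kendall_conv \<alpha> (return borel x) \<mu>) A) \<in> borel_measurable borel"
    and "measure (kendall_conv \<alpha> (return borel x) \<mu>) A \<le> 1"
    and "emeasure (kendall_conv \<alpha> (return borel x) \<mu>) A = ennreal (measure (kendall_conv \<alpha> (return borel x) \<mu>) A)"
proof -
  let ?K = "\<lambda>x. kendall_conv \<alpha> (return borel x) \<mu>"
  note K = measurable_kendall_kernel[OF assms]
  have sp: "prob_space (?K x)" "sets (?K x) = sets borel" for x
    using measurable_space[OF K, of x] by (auto simp: space_prob_algebra)
  then show "measure (?K x) A \<le> 1"
    by (intro prob_space.prob_le_1)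
  interpret K: prob_space "?K x" by (rule sp)
  show "emeasure (?K x) A = ennreal (measure (?K x) A)"
    by (rule K.emeasure_eq_measure)
  show "(\<lambda>x. measure (?K x) A) \<in> borel_measurable borel"
  proof (cases "A \<in> sets borel")
    case True
    show ?thesis
      by (rule measurable_compose[OF measurable_prob_algebraD[OF K] measurable_measure_subprob_algebra[OF True]])
  next
    case False
    then have "measure (?K x) A = 0" for x
      using sp by (intro measure_notin_sets) simp
    then show ?thesis by simp
  qed
qed

text \<open>
  The Markov property for neighbouring times expresses the law of the past up to time
  \<open>k + 1\<close> through the law of the past up to time \<open>k\<close> and the kernel \<open>x \<mapsto> \<delta>\<^sub>x \<triangle> \<nu>\<close>.
\<close>

lemma kendall_random_walk_one_step:
  assumes \<alpha>: "\<alpha> > 0" and \<nu>: "prob_on_nonneg \<nu>" and walk: "kendall_random_walk \<alpha> \<nu> M X"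
    and B: "B \<in> sets (\<Pi>\<^sub>M i\<in>{..k}. borel)" and A: "A \<in> sets borel"
  shows "emeasure M {\<omega>\<in>space M. (\<lambda>i\<in>{..k}. X i \<omega>) \<in> B \<and> X (Suc k) \<omega> \<in> A} =
    (\<integral>\<^sup>+p. emeasure (kendall_conv \<alpha> (return borel (p k)) \<nu>) A * indicator B p
       \<partial>distr M (\<Pi>\<^sub>M i\<in>{..k}. borel) (\<lambda>\<omega>. \<lambda>i\<in>{..k}. X i \<omega>))"
proof -
  let ?S = "\<Pi>\<^sub>M i\<in>{..k}. (borel :: real measure)" and ?Y = "\<lambda>\<omega>. \<lambda>i\<in>{..k}. X i \<omega>"
  let ?g = "\<lambda>p. measure (kendall_conv \<alpha> (return borel (p k)) \<nu>) A"
  have X [measurable]: "X n \<in> borel_measurable M" for n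
    using walk by (simp add: kendall_random_walk_def)
  note B [measurable] A [measurable]
  have Y: "?Y \<in> measurable M ?S" by (rule measurable_past) (rule X)
  have "(\<lambda>p. p k) \<in> borel_measurable ?S"
    by (rule measurable_component_singleton) simp
  then have g: "?g \<in> borel_measurable ?S"
    by (rule measurable_compose) (rule measure_kendall_kernel_bounds[OF \<alpha> \<nu>])
  have "kendall_power \<alpha> \<nu> (Suc k - k) = \<nu>"
    by (simp add: kendall_conv_zero_left[OF \<alpha> \<nu>])
  moreover have "AE \<omega> in M. cond_prob_given M {\<omega>'\<in>space M. X (Suc k) \<omega>' \<in> A} ?S ?Y \<omega> =
      measure (kendall_conv \<alpha> (return borel (X k \<omega>)) (kendall_power \<alpha> \<nu> (Suc k - k))) A"
    using walk A lessI[of k] unfolding kendall_random_walk_def by blast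
  ultimately have "AE \<omega> in M. cond_prob_given M {\<omega>'\<in>space M. X (Suc k) \<omega>' \<in> A} ?S ?Y \<omega> = ?g (?Y \<omega>)"
    by simp
  then have "emeasure M (?Y -` B \<inter> space M \<inter> {\<omega>'\<in>space M. X (Suc k) \<omega>' \<in> A}) =
      (\<integral>\<^sup>+\<omega>. ennreal (?g (?Y \<omega>)) * indicator B (?Y \<omega>) \<partial>M)"
    using walk by (intro emeasure_Int_of_cond_prob_given[OF _ Y _ g _ _ B])
      (auto simp: kendall_random_walk_def)
  also have "?Y -` B \<inter> space M \<inter> {\<omega>'\<in>space M. X (Suc k) \<omega>' \<in> A} =
      {\<omega>\<in>space M. ?Y \<omega> \<in> B \<and> X (Suc k) \<omega> \<in> A}"
    by auto
  also have "(\<integral>\<^sup>+\<omega>. ennreal (?g (?Y \<omega>)) * indicator B (?Y \<omega>) \<partial>M) =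
      (\<integral>\<^sup>+p. ennreal (?g p) * indicator B p \<partial>distr M ?S ?Y)"
  proof (rule nn_integral_distr[OF Y, symmetric])
    have "(\<lambda>p. ennreal (?g p) * indicator B p) \<in> borel_measurable ?S"
      by (intro borel_measurable_times_ennreal measurable_compose[OF g measurable_ennreal] borel_measurable_indicator B)
    then show "(\<lambda>p. ennreal (?g p) * indicator B p) \<in> borel_measurable (distr M ?S ?Y)"
      by simp
  qed
  finally show ?thesis
    by (simp only: measure_kendall_kernel_bounds(3)[OF \<alpha> \<nu>])
qed

text \<open>
  Induction on the number of time points: the walk starts at \<open>0\<close>, and by the previous lemma the
  law of the past up to time \<open>k\<close> fixes the probabilities of all boxes up to time \<open>k + 1\<close>.
\<close>

lemma kendall_random_walk_past_law_unique:
  assumes \<alpha>: "\<alpha> > 0" and \<nu>: "prob_on_nonneg \<nu>"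
    and walk: "kendall_random_walk \<alpha> \<nu> M X" and walk': "kendall_random_walk \<alpha> \<nu> M' X'"
  shows "distr M (\<Pi>\<^sub>M i\<in>{..k}. borel) (\<lambda>\<omega>. \<lambda>i\<in>{..k}. X i \<omega>) =
    distr M' (\<Pi>\<^sub>M i\<in>{..k}. borel) (\<lambda>\<omega>. \<lambda>i\<in>{..k}. X' i \<omega>)"
proof (induction k)
  case 0
  have "distr N (\<Pi>\<^sub>M i\<in>{..0}. borel) (\<lambda>\<omega>. \<lambda>i\<in>{..0}. Z i \<omega>) =
      return (\<Pi>\<^sub>M i\<in>{..0}. borel) (\<lambda>i\<in>{..0::nat}. 0)"
    if Z: "kendall_random_walk \<alpha> \<nu> N Z" for N :: "'z measure" and Z
  proof -
    interpret prob_space N using Z by (simp add: kendall_random_walk_def)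
    have "AE \<omega> in N. (\<lambda>i\<in>{..0}. Z i \<omega>) = (\<lambda>i\<in>{..0::nat}. 0)"
      using Z unfolding kendall_random_walk_def by (auto elim!: eventually_mono simp: restrict_def fun_eq_iff)
    moreover have "(\<lambda>\<omega>. \<lambda>i\<in>{..0}. Z i \<omega>) \<in> measurable N (\<Pi>\<^sub>M i\<in>{..0::nat}. borel)"
      using Z by (intro measurable_past) (simp add: kendall_random_walk_def)
    ultimately have "distr N (\<Pi>\<^sub>M i\<in>{..0}. borel) (\<lambda>\<omega>. \<lambda>i\<in>{..0}. Z i \<omega>) =
        distr N (\<Pi>\<^sub>M i\<in>{..0}. borel) (\<lambda>\<omega>. \<lambda>i\<in>{..0::nat}. 0)"
      by (intro distr_cong_AE) (auto simp: space_PiM)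
    then show ?thesis by (simp add: space_PiM)
  qed
  from this[OF walk] this[OF walk'] show ?case
    by (rule trans[OF _ sym])
next
  case (Suc k)
  let ?S = "\<lambda>k. \<Pi>\<^sub>M i\<in>{..k::nat}. (borel :: real measure)"
  have X: "X n \<in> borel_measurable M" "X' n \<in> borel_measurable M'" for n
    using walk walk' by (simp_all add: kendall_random_walk_def)
  have split_rect: "emeasure (distr N (?S (Suc k)) (\<lambda>\<omega>. \<lambda>i\<in>{..Suc k}. Z i \<omega>)) (Pi\<^sub>E {..Suc k} A) =
      emeasure N {\<omega>\<in>space N. (\<lambda>i\<in>{..k}. Z i \<omega>) \<in> Pi\<^sub>E {..k} A \<and> Z (Suc k) \<omega> \<in> A (Suc k)}"
    if Z: "\<And>n. Z n \<in> borel_measurable N" and A: "\<And>i. i \<in> {..Suc k} \<Longrightarrow> A i \<in> sets borel"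
    for N :: "'z measure" and Z :: "nat \<Rightarrow> 'z \<Rightarrow> real" and A
  proof -
    have "emeasure (distr N (?S (Suc k)) (\<lambda>\<omega>. \<lambda>i\<in>{..Suc k}. Z i \<omega>)) (Pi\<^sub>E {..Suc k} A) =
        emeasure N ((\<lambda>\<omega>. \<lambda>i\<in>{..Suc k}. Z i \<omega>) -` Pi\<^sub>E {..Suc k} A \<inter> space N)"
      using A by (intro emeasure_distr measurable_past Z sets_PiM_I_finite) auto
    also have "(\<lambda>\<omega>. \<lambda>i\<in>{..Suc k}. Z i \<omega>) -` Pi\<^sub>E {..Suc k} A \<inter> space N =
        {\<omega>\<in>space N. (\<lambda>i\<in>{..k}. Z i \<omega>) \<in> Pi\<^sub>E {..k} A \<and> Z (Suc k) \<omega> \<in> A (Suc k)}"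
      by (auto simp: restrict_PiE_iff atMost_Suc)
    finally show ?thesis .
  qed
  show ?case
  proof (rule measure_eqI_PiM_finite[where M="\<lambda>_. borel" and A="\<lambda>_::nat. space (?S (Suc k))"])
    fix A :: "nat \<Rightarrow> real set" assume A: "\<And>i. i \<in> {..Suc k} \<Longrightarrow> A i \<in> sets borel"
    have B: "Pi\<^sub>E {..k} A \<in> sets (?S k)" and A': "A (Suc k) \<in> sets borel"
      using A by (auto intro!: sets_PiM_I_finite)
    show "emeasure (distr M (?S (Suc k)) (\<lambda>\<omega>. \<lambda>i\<in>{..Suc k}. X i \<omega>)) (Pi\<^sub>E {..Suc k} A) =
        emeasure (distr M' (?S (Suc k)) (\<lambda>\<omega>. \<lambda>i\<in>{..Suc k}. X' i \<omega>)) (Pi\<^sub>E {..Suc k} A)"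
      using split_rect[OF X(1), of A] split_rect[OF X(2), of A] A
      by (simp only: kendall_random_walk_one_step[OF \<alpha> \<nu> walk B A']
          kendall_random_walk_one_step[OF \<alpha> \<nu> walk' B A'] Suc.IH)
  next
    interpret D: prob_space "distr M (?S (Suc k)) (\<lambda>\<omega>. \<lambda>i\<in>{..Suc k}. X i \<omega>)"
      using walk X by (intro prob_space.prob_space_distr measurable_past) (auto simp: kendall_random_walk_def)
    show "emeasure (distr M (?S (Suc k)) (\<lambda>\<omega>. \<lambda>i\<in>{..Suc k}. X i \<omega>)) (space (?S (Suc k))) \<noteq> \<infinity>"
      by simp
  qed (auto simp: space_PiM intro!: prod_algebraI_finite)
qed

lemma kendall_random_walk_path_law_unique:
  assumes \<alpha>: "\<alpha> > 0" and \<nu>: "prob_on_nonneg \<nu>"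
    and walk: "kendall_random_walk \<alpha> \<nu> M X" and walk': "kendall_random_walk \<alpha> \<nu> M' X'"
  shows "path_law M X = path_law M' X'"
  unfolding path_law_def
proof (rule measure_eqI_PiM_infinite)
  have X: "X n \<in> borel_measurable M" "X' n \<in> borel_measurable M'" for n
    using walk walk' by (simp_all add: kendall_random_walk_def)
  have path: "(\<lambda>\<omega> n. Z n \<omega>) \<in> measurable N (\<Pi>\<^sub>M n\<in>UNIV. borel)"
    if "\<And>n. Z n \<in> borel_measurable N" for N :: "'z measure" and Z :: "nat \<Rightarrow> 'z \<Rightarrow> real"
    using that by (intro measurable_PiM_single') (auto simp: space_PiM)
  have "prob_space M" using walk by (simp add: kendall_random_walk_def)
  then show "finite_measure (distr M (\<Pi>\<^sub>M n\<in>UNIV. borel) (\<lambda>\<omega> n. X n \<omega>))"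
    by (intro finite_measure.finite_measure_distr prob_space.axioms path X)
  fix A :: "nat \<Rightarrow> real set" and J :: "nat set"
  assume J: "finite J" "J \<subseteq> UNIV" and A: "\<And>i. i \<in> J \<Longrightarrow> A i \<in> sets borel"
  \<comment> \<open>a cylinder over finitely many times is a box in the past up to their maximum\<close>
  obtain k where k: "J \<subseteq> {..k}" using J finite_nat_set_iff_bounded_le by (auto simp: subset_eq)
  let ?A = "\<lambda>i. if i \<in> J then A i else UNIV"
  let ?S = "\<Pi>\<^sub>M i\<in>{..k}. (borel :: real measure)"
  have cyl: "emeasure (distr N (\<Pi>\<^sub>M n\<in>UNIV. borel) (\<lambda>\<omega> n. Z n \<omega>)) (prod_emb UNIV (\<lambda>_. borel) J (Pi\<^sub>E J A)) =
      emeasure (distr N ?S (\<lambda>\<omega>. \<lambda>i\<in>{..k}. Z i \<omega>)) (Pi\<^sub>E {..k} ?A)"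
    if Z: "\<And>n. Z n \<in> borel_measurable N" for N :: "'z measure" and Z :: "nat \<Rightarrow> 'z \<Rightarrow> real"
  proof -
    have "emeasure (distr N (\<Pi>\<^sub>M n\<in>UNIV. borel) (\<lambda>\<omega> n. Z n \<omega>)) (prod_emb UNIV (\<lambda>_. borel) J (Pi\<^sub>E J A)) =
        emeasure N ((\<lambda>\<omega> n. Z n \<omega>) -` prod_emb UNIV (\<lambda>_. borel) J (Pi\<^sub>E J A) \<inter> space N)"
      using A J by (intro emeasure_distr path Z sets_PiM_I) auto
    also have "(\<lambda>\<omega> n. Z n \<omega>) -` prod_emb UNIV (\<lambda>_. borel) J (Pi\<^sub>E J A) \<inter> space N =
        (\<lambda>\<omega>. \<lambda>i\<in>{..k}. Z i \<omega>) -` Pi\<^sub>E {..k} ?A \<inter> space N"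
      using k by (auto simp: prod_emb_def restrict_PiE_iff Pi_iff split: if_splits) blast
    also have "emeasure N \<dots> = emeasure (distr N ?S (\<lambda>\<omega>. \<lambda>i\<in>{..k}. Z i \<omega>)) (Pi\<^sub>E {..k} ?A)"
      using A by (intro emeasure_distr[symmetric] measurable_past Z sets_PiM_I_finite) auto
    finally show ?thesis .
  qed
  show "emeasure (distr M (\<Pi>\<^sub>M n\<in>UNIV. borel) (\<lambda>\<omega> n. X n \<omega>)) (prod_emb UNIV (\<lambda>_. borel) J (Pi\<^sub>E J A)) =
      emeasure (distr M' (\<Pi>\<^sub>M n\<in>UNIV. borel) (\<lambda>\<omega> n. X' n \<omega>)) (prod_emb UNIV (\<lambda>_. borel) J (Pi\<^sub>E J A))"
    unfolding cyl[OF X(1)] cyl[OF X(2)] kendall_random_walk_past_law_unique[OF \<alpha> \<nu> walk walk'] ..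
qed simp_all

section \<open>The driving noise and one step of the recursion\<close>

definition unif01 :: "real measure" where
  "unif01 = uniform_measure lborel {0<..<1}"

definition coin_law :: "real \<Rightarrow> (real \<times> real) measure" where
  "coin_law \<alpha> = pareto (2 * \<alpha>) \<Otimes>\<^sub>M unif01"

definition noise_law :: "real \<Rightarrow> real measure \<Rightarrow> (real \<times> real \<times> real) measure" where
  "noise_law \<alpha> \<nu> = \<nu> \<Otimes>\<^sub>M coin_law \<alpha>"

text \<open>
  The coordinate with number \<open>n\<close> carries the triple \<open>(\<Delta>X\<^sub>n\<^sub>+\<^sub>1, \<theta>\<^sub>n, U\<^sub>n)\<close> with \<open>U\<^sub>n\<close> uniform on the
  unit interval. With this offset, \<open>X\<^sub>n\<^sub>+\<^sub>1\<close> is a function of \<open>X\<^sub>n\<close> and coordinate \<open>n\<close> alone, while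
  \<open>X\<^sub>n\<close> depends only on smaller coordinates.
\<close>

definition noise_space :: "real \<Rightarrow> real measure \<Rightarrow> (nat \<Rightarrow> real \<times> real \<times> real) measure" where
  "noise_space \<alpha> \<nu> = (\<Pi>\<^sub>M n\<in>UNIV. noise_law \<alpha> \<nu>)"

text \<open>
  The absolute values keep the path nonnegative at every sample point. They change nothing
  in law, because \<open>\<nu>\<close> and the Pareto law are carried by the nonnegative numbers. The comparison of
  \<open>U\<^sub>n\<close> with \<open>z\<^sup>\<alpha>\<close> realises an event of conditional probability \<open>z\<^sup>\<alpha>\<close>.
\<close>

definition kendall_step :: "real \<Rightarrow> real \<Rightarrow> real \<times> real \<times> real \<Rightarrow> real" where
  "kendall_step \<alpha> x w =
     (let v = max x \<bar>fst w\<bar> in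
      if snd (snd w) < kendall_z x \<bar>fst w\<bar> powr \<alpha> then v * \<bar>fst (snd w)\<bar> else v)"

primrec kendall_path :: "real \<Rightarrow> nat \<Rightarrow> (nat \<Rightarrow> real \<times> real \<times> real) \<Rightarrow> real" where
  "kendall_path \<alpha> 0 \<omega> = 0"
| "kendall_path \<alpha> (Suc n) \<omega> = kendall_step \<alpha> (kendall_path \<alpha> n \<omega>) (\<omega> n)"

text \<open>
  Only the indices \<open>n \<ge> 1\<close> are meaningful; the truncated subtraction undoes the offset of the
  coordinates.
\<close>

definition increment :: "nat \<Rightarrow> (nat \<Rightarrow> real \<times> real \<times> real) \<Rightarrow> real" where
  "increment n \<omega> = \<bar>fst (\<omega> (n - 1))\<bar>"

definition pareto_factor :: "nat \<Rightarrow> (nat \<Rightarrow> real \<times> real \<times> real) \<Rightarrow> real" where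
  "pareto_factor n \<omega> = \<bar>fst (snd (\<omega> n))\<bar>"

definition switch :: "real \<Rightarrow> nat \<Rightarrow> (nat \<Rightarrow> real \<times> real \<times> real) \<Rightarrow> nat" where
  "switch \<alpha> n \<omega> =
     (if snd (snd (\<omega> n)) < kendall_z (kendall_path \<alpha> n \<omega>) (increment (n + 1) \<omega>) powr \<alpha> then 1 else 0)"

lemma increment_Suc: "increment (Suc n) \<omega> = \<bar>fst (\<omega> n)\<bar>"
  by (simp add: increment_def)

lemma kendall_path_recursion:
  "kendall_path \<alpha> (Suc n) \<omega> =
     max (kendall_path \<alpha> n \<omega>) (increment (Suc n) \<omega>) * pareto_factor n \<omega> ^ switch \<alpha> n \<omega>"
  by (simp add: kendall_step_def Let_def switch_def increment_Suc pareto_factor_def)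

lemma kendall_path_nonneg: "0 \<le> kendall_path \<alpha> n \<omega>"
  by (cases n) (auto simp: kendall_step_def Let_def max_def)

lemma kendall_path_fresh: "k \<le> n \<Longrightarrow> kendall_path \<alpha> k (fun_upd \<omega> n w) = kendall_path \<alpha> k \<omega>"
  by (induction k) auto

lemma kendall_z_powr_bounds:
  assumes "\<alpha> > 0" "0 \<le> x" "0 \<le> y"
  shows "0 \<le> kendall_z x y powr \<alpha>" "kendall_z x y powr \<alpha> \<le> 1"
proof -
  have "0 \<le> kendall_z x y" "kendall_z x y \<le> 1"
    using assms by (auto simp: kendall_z_def divide_le_eq max_def min_def)
  with assms show "kendall_z x y powr \<alpha> \<le> 1" by (intro powr_le1) auto
qed simp

lemma measurable_kendall_z [measurable]:
  assumes [measurable]: "f \<in> borel_measurable M" "g \<in> borel_measurable M"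
  shows "(\<lambda>x. kendall_z (f x) (g x)) \<in> borel_measurable M"
  unfolding kendall_z_def by measurable

lemma sets_unif01 [measurable_cong]: "sets unif01 = sets borel"
  by (simp add: unif01_def)

lemma prob_space_unif01: "prob_space unif01"
  unfolding unif01_def by (intro prob_space_uniform_measure) auto

lemma emeasure_unif01:
  assumes "0 \<le> p" "p \<le> 1"
  shows "emeasure unif01 {..<p} = ennreal p" "emeasure unif01 {p..} = ennreal (1 - p)"
proof -
  have "{0<..<1} \<inter> {..<p} = {0<..<p}" using assms by auto
  then show "emeasure unif01 {..<p} = ennreal p"
    using assms divide_ennreal[of p 1] by (simp add: unif01_def)
  then have "emeasure unif01 (space unif01 - {..<p}) = 1 - ennreal p"
    using prob_space.emeasure_space_1[OF prob_space_unif01]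
    by (subst emeasure_compl) (auto simp: sets_unif01)
  moreover have "space unif01 - {..<p} = {p..}"
    by (auto simp: unif01_def)
  ultimately show "emeasure unif01 {p..} = ennreal (1 - p)"
    using assms by (simp flip: ennreal_minus)
qed

lemma AE_pareto_gt_1: "AE t in pareto \<beta>. 1 < t"
  unfolding pareto_def by (subst AE_density) (auto simp: indicator_def)

lemma sets_coin_law [measurable_cong]: "sets (coin_law \<alpha>) = sets (borel \<Otimes>\<^sub>M borel)"
  unfolding coin_law_def by (intro sets_pair_measure_cong sets_pareto sets_unif01)

lemma sets_noise_law:
  "prob_on_nonneg \<nu> \<Longrightarrow> sets (noise_law \<alpha> \<nu>) = sets (borel \<Otimes>\<^sub>M borel \<Otimes>\<^sub>M borel)"
  unfolding noise_law_def prob_on_nonneg_def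
  by (intro sets_pair_measure_cong sets_coin_law) simp

lemma prob_space_coin_law: "\<alpha> > 0 \<Longrightarrow> prob_space (coin_law \<alpha>)"
  unfolding coin_law_def by (intro prob_space_pair prob_space_pareto prob_space_unif01) simp

lemma prob_space_noise_law: "\<alpha> > 0 \<Longrightarrow> prob_on_nonneg \<nu> \<Longrightarrow> prob_space (noise_law \<alpha> \<nu>)"
  unfolding noise_law_def prob_on_nonneg_def by (intro prob_space_pair prob_space_coin_law) simp_all

lemma prob_space_noise_space: "\<alpha> > 0 \<Longrightarrow> prob_on_nonneg \<nu> \<Longrightarrow> prob_space (noise_space \<alpha> \<nu>)"
  unfolding noise_space_def by (intro prob_space_PiM prob_space_noise_law)

text \<open>
  Integrating out the pair \<open>(\<theta>, U)\<close> turns a choice made by comparing \<open>U\<close> with \<open>p\<close> into a mixture with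
  weights \<open>p\<close> and \<open>1 - p\<close>. The conditional laws of
  \<open>Q\<^sub>n\<close> and \<open>X\<^sub>n\<^sub>+\<^sub>1\<close> rest on this.
\<close>

lemma nn_integral_coin_law:
  assumes "\<alpha> > 0" and p: "0 \<le> p" "p \<le> 1"
    and [measurable]: "g1 \<in> borel_measurable borel" "g0 \<in> borel_measurable borel"
  shows "(\<integral>\<^sup>+r. (if snd r < p then g1 \<bar>fst r\<bar> else g0 \<bar>fst r\<bar>) \<partial>coin_law \<alpha>) =
    ennreal p * (\<integral>\<^sup>+t. g1 t \<partial>pareto (2 * \<alpha>)) + ennreal (1 - p) * (\<integral>\<^sup>+t. g0 t \<partial>pareto (2 * \<alpha>))"
proof -
  interpret U: prob_space unif01 by (rule prob_space_unif01)
  note sets_pareto [measurable_cong]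
  have "(\<integral>\<^sup>+r. (if snd r < p then g1 \<bar>fst r\<bar> else g0 \<bar>fst r\<bar>) \<partial>coin_law \<alpha>) =
      (\<integral>\<^sup>+t. (\<integral>\<^sup>+u. (if u < p then g1 \<bar>t\<bar> else g0 \<bar>t\<bar>) \<partial>unif01) \<partial>pareto (2 * \<alpha>))"
    unfolding coin_law_def by (subst U.nn_integral_fst[symmetric]) (simp_all cong: if_cong)
  also have "\<dots> = (\<integral>\<^sup>+t. ennreal p * g1 t + ennreal (1 - p) * g0 t \<partial>pareto (2 * \<alpha>))"
  proof (rule nn_integral_cong_AE)
    show "AE t in pareto (2 * \<alpha>). (\<integral>\<^sup>+u. (if u < p then g1 \<bar>t\<bar> else g0 \<bar>t\<bar>) \<partial>unif01) =
        ennreal p * g1 t + ennreal (1 - p) * g0 t"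
      using AE_pareto_gt_1
    proof eventually_elim
      case (elim t)
      have "(\<integral>\<^sup>+u. (if u < p then g1 \<bar>t\<bar> else g0 \<bar>t\<bar>) \<partial>unif01) =
          (\<integral>\<^sup>+u. g1 t * indicator {..<p} u + g0 t * indicator {p..} u \<partial>unif01)"
        using elim by (intro nn_integral_cong) (auto split: split_indicator)
      also have "\<dots> = g1 t * emeasure unif01 {..<p} + g0 t * emeasure unif01 {p..}"
        by (simp add: nn_integral_add nn_integral_cmult_indicator sets_unif01)
      finally show ?case by (simp add: emeasure_unif01 p mult.commute)
    qed
  qed
  also have "\<dots> = ennreal p * (\<integral>\<^sup>+t. g1 t \<partial>pareto (2 * \<alpha>)) + ennreal (1 - p) * (\<integral>\<^sup>+t. g0 t \<partial>pareto (2 * \<alpha>))"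
    by (simp add: nn_integral_add nn_integral_cmult)
  finally show ?thesis .
qed

lemma nn_integral_pareto_const: "\<alpha> > 0 \<Longrightarrow> (\<integral>\<^sup>+t. c \<partial>pareto (2 * \<alpha>)) = c"
  using prob_space.emeasure_space_1[OF prob_space_pareto[of "2 * \<alpha>"]] by simp

text \<open>
  Given the position \<open>x\<close> and the increment \<open>\<bar>y\<bar>\<close>, the recursion produces their point convolution: this
  is its definition as a mixture, read off from the integral over the coin. At
  \<open>x = y = 0\<close> the convention \<open>z = 0\<close> makes the position stay at \<open>0\<close>.
\<close>

lemma nn_integral_kendall_step_point:
  assumes "\<alpha> > 0" "0 \<le> x" and [measurable]: "f \<in> borel_measurable borel"
  shows "(\<integral>\<^sup>+r. f (kendall_step \<alpha> x (y, r)) \<partial>coin_law \<alpha>) = (\<integral>\<^sup>+z. f z \<partial>kendall_point \<alpha> x \<bar>y\<bar>)"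
proof -
  define p where "p = kendall_z x \<bar>y\<bar> powr \<alpha>"
  define v where "v = max x \<bar>y\<bar>"
  note sets_pareto [measurable_cong]
  have p: "0 \<le> p" "p \<le> 1"
    using kendall_z_powr_bounds[of \<alpha> x "\<bar>y\<bar>"] assms by (simp_all add: p_def)
  have "(\<integral>\<^sup>+r. f (kendall_step \<alpha> x (y, r)) \<partial>coin_law \<alpha>) =
      (\<integral>\<^sup>+r. (if snd r < p then f (v * \<bar>fst r\<bar>) else f v) \<partial>coin_law \<alpha>)"
    by (intro nn_integral_cong) (simp add: kendall_step_def p_def v_def Let_def)
  also have "\<dots> = ennreal p * (\<integral>\<^sup>+t. f (v * t) \<partial>pareto (2 * \<alpha>)) + ennreal (1 - p) * f v"
    using assms p by (subst nn_integral_coin_law[where ?g1.0="\<lambda>t. f (v * t)" and ?g0.0="\<lambda>_. f v"])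
      (simp_all only: nn_integral_pareto_const, measurable)
  also have "(\<integral>\<^sup>+t. f (v * t) \<partial>pareto (2 * \<alpha>)) = (\<integral>\<^sup>+z. f z \<partial>scale_law v (pareto (2 * \<alpha>)))"
    unfolding scale_law_def by (subst nn_integral_distr) simp_all
  also have "ennreal p * \<dots> + ennreal (1 - p) * f v = (\<integral>\<^sup>+z. f z \<partial>kendall_point \<alpha> x \<bar>y\<bar>)"
  proof (cases "v = 0")
    case True
    then have "x = 0" "\<bar>y\<bar> = 0" using assms by (auto simp: v_def max_def split: if_splits)
    then show ?thesis by (simp add: kendall_point_zero p_def v_def kendall_z_def nn_integral_return)
  next
    case False
    have "kendall_point \<alpha> x \<bar>y\<bar> = kendall_point \<alpha> (min x \<bar>y\<bar>) v"
      by (cases "x \<le> \<bar>y\<bar>") (simp_all add: v_def kendall_point_commute min_def max_def)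
    moreover have "min x \<bar>y\<bar> powr \<alpha> / v powr \<alpha> = p"
      using assms by (simp add: p_def kendall_z_def v_def powr_divide)
    moreover have "0 \<le> min x \<bar>y\<bar>" "min x \<bar>y\<bar> \<le> v" "0 < v"
      using assms False by (auto simp: v_def max_def min_def split: if_splits)
    ultimately show ?thesis
      using nn_integral_kendall_point[of \<alpha> "min x \<bar>y\<bar>" v f] assms by (simp add: add.commute)
  qed
  finally show ?thesis .
qed

lemma measurable_kendall_step [measurable]:
  assumes [measurable]: "f \<in> borel_measurable M" "g \<in> measurable M (borel \<Otimes>\<^sub>M borel \<Otimes>\<^sub>M borel)"
  shows "(\<lambda>\<omega>. kendall_step \<alpha> (f \<omega>) (g \<omega>)) \<in> borel_measurable M"
  unfolding kendall_step_def Let_def by measurable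

lemma nn_integral_kendall_step:
  assumes "\<alpha> > 0" "prob_on_nonneg \<nu>" "0 \<le> x" and [measurable]: "f \<in> borel_measurable borel"
  shows "(\<integral>\<^sup>+w. f (kendall_step \<alpha> x w) \<partial>noise_law \<alpha> \<nu>) =
    (\<integral>\<^sup>+z. f z \<partial>kendall_conv \<alpha> (return borel x) \<nu>)"
proof -
  interpret C: prob_space "coin_law \<alpha>" using assms by (intro prob_space_coin_law)
  note sets_noise_law[OF assms(2), measurable_cong]
  have "(\<lambda>w. f (kendall_step \<alpha> x w)) \<in> borel_measurable (\<nu> \<Otimes>\<^sub>M coin_law \<alpha>)"
    unfolding noise_law_def[symmetric] by measurable
  then have "(\<integral>\<^sup>+w. f (kendall_step \<alpha> x w) \<partial>noise_law \<alpha> \<nu>) =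
      (\<integral>\<^sup>+y. (\<integral>\<^sup>+r. f (kendall_step \<alpha> x (y, r)) \<partial>coin_law \<alpha>) \<partial>\<nu>)"
    unfolding noise_law_def by (rule C.nn_integral_fst[symmetric])
  also have "\<dots> = (\<integral>\<^sup>+y. (\<integral>\<^sup>+z. f z \<partial>kendall_point \<alpha> x \<bar>y\<bar>) \<partial>\<nu>)"
    by (simp add: nn_integral_kendall_step_point assms)
  also have "\<dots> = (\<integral>\<^sup>+y. (\<integral>\<^sup>+z. f z \<partial>kendall_point \<alpha> x y) \<partial>\<nu>)"
    using AE_nonneg_prob_on_nonneg[OF assms(2)]
    by (intro nn_integral_cong_AE) (auto elim!: eventually_mono)
  also have "\<dots> = (\<integral>\<^sup>+z. f z \<partial>kendall_conv \<alpha> (return borel x) \<nu>)"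
    using assms by (intro nn_integral_kendall_kernel[symmetric]) auto
  finally show ?thesis .
qed

section \<open>The process on the product space\<close>

context
  fixes \<alpha> :: real and \<nu> :: "real measure"
  assumes \<alpha>: "\<alpha> > 0" and \<nu>: "prob_on_nonneg \<nu>"
begin

interpretation noise: product_prob_space "\<lambda>_. noise_law \<alpha> \<nu>" "UNIV :: nat set"
  by (intro product_prob_spaceI prob_space_noise_law \<alpha> \<nu>)

interpretation coin: prob_space "coin_law \<alpha>"
  by (intro prob_space_coin_law \<alpha>)

interpretation M: prob_space "noise_space \<alpha> \<nu>"
  by (intro prob_space_noise_space \<alpha> \<nu>)

lemma space_noise_space: "space (noise_space \<alpha> \<nu>) = UNIV"
  using sets_eq_imp_space_eq[OF sets_noise_law[OF \<nu>, of \<alpha>]]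
  by (simp add: noise_space_def space_PiM space_pair_measure)

lemma measurable_noise [measurable]:
  "(\<lambda>\<omega>. \<omega> n) \<in> measurable (noise_space \<alpha> \<nu>) (borel \<Otimes>\<^sub>M borel \<Otimes>\<^sub>M borel)"
proof -
  have "(\<lambda>\<omega>. \<omega> n) \<in> measurable (noise_space \<alpha> \<nu>) (noise_law \<alpha> \<nu>)"
    unfolding noise_space_def by (rule measurable_component_singleton) simp
  then show ?thesis
    unfolding measurable_cong_sets[OF refl sets_noise_law[OF \<nu>]] .
qed

lemma measurable_kendall_path [measurable]: "kendall_path \<alpha> n \<in> borel_measurable (noise_space \<alpha> \<nu>)"
  by (induction n) simp_all

lemma measurable_increment [measurable]: "increment n \<in> borel_measurable (noise_space \<alpha> \<nu>)"
  unfolding increment_def by measurable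

lemma measurable_pareto_factor [measurable]: "pareto_factor n \<in> borel_measurable (noise_space \<alpha> \<nu>)"
  unfolding pareto_factor_def by measurable

lemma measurable_switch [measurable]: "switch \<alpha> n \<in> measurable (noise_space \<alpha> \<nu>) (count_space UNIV)"
  unfolding switch_def by measurable

text \<open>
  A variable that ignores coordinate \<open>n\<close> is independent of that coordinate, stated as the
  possibility to integrate the coordinate out.
\<close>

lemma nn_integral_fresh_noise:
  assumes F: "F \<in> measurable (noise_space \<alpha> \<nu>) N"
    and fresh: "\<And>\<omega> w. F (fun_upd \<omega> n w) = F \<omega>"
    and h: "h \<in> borel_measurable (N \<Otimes>\<^sub>M borel \<Otimes>\<^sub>M borel \<Otimes>\<^sub>M borel)"
  shows "(\<integral>\<^sup>+\<omega>. h (F \<omega>, \<omega> n) \<partial>noise_space \<alpha> \<nu>) =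
    (\<integral>\<^sup>+\<omega>. (\<integral>\<^sup>+w. h (F \<omega>, w) \<partial>noise_law \<alpha> \<nu>) \<partial>noise_space \<alpha> \<nu>)"
proof -
  have "sets (N \<Otimes>\<^sub>M noise_law \<alpha> \<nu>) = sets (N \<Otimes>\<^sub>M borel \<Otimes>\<^sub>M borel \<Otimes>\<^sub>M borel)"
    by (intro sets_pair_measure_cong sets_noise_law \<nu> refl)
  then have "h \<in> borel_measurable (N \<Otimes>\<^sub>M noise_law \<alpha> \<nu>)"
    using h by (simp cong: measurable_cong_sets)
  with F fresh show ?thesis
    unfolding noise_space_def by (intro noise.nn_integral_PiM_fresh_coordinate) auto
qed

lemma nn_integral_noise_law:
  assumes "h \<in> borel_measurable (borel \<Otimes>\<^sub>M borel \<Otimes>\<^sub>M borel)"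
  shows "(\<integral>\<^sup>+w. h w \<partial>noise_law \<alpha> \<nu>) = (\<integral>\<^sup>+y. (\<integral>\<^sup>+r. h (y, r) \<partial>coin_law \<alpha>) \<partial>\<nu>)"
proof -
  have "h \<in> borel_measurable (\<nu> \<Otimes>\<^sub>M coin_law \<alpha>)"
    using assms unfolding noise_law_def[symmetric] by (simp add: sets_noise_law[OF \<nu>] cong: measurable_cong_sets)
  then show ?thesis
    unfolding noise_law_def by (rule coin.nn_integral_fst[symmetric])
qed

text \<open>
  As before, but only \<open>(\<theta>\<^sub>n, U\<^sub>n)\<close> is integrated out, while \<open>X\<^sub>n\<close> and \<open>\<Delta>X\<^sub>n\<^sub>+\<^sub>1\<close> are kept. The
  increment is integrated out and then restored by the same rule read backwards.
\<close>

lemma nn_integral_fresh_coin: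
  assumes F [measurable]: "F \<in> measurable (noise_space \<alpha> \<nu>) N"
    and fresh: "\<And>\<omega> w. F (fun_upd \<omega> n w) = F \<omega>"
    and h [measurable]: "h \<in> borel_measurable (N \<Otimes>\<^sub>M borel \<Otimes>\<^sub>M borel \<Otimes>\<^sub>M borel)"
  shows "(\<integral>\<^sup>+\<omega>. h (F \<omega>, \<omega> n) \<partial>noise_space \<alpha> \<nu>) =
    (\<integral>\<^sup>+\<omega>. (\<integral>\<^sup>+r. h (F \<omega>, fst (\<omega> n), r) \<partial>coin_law \<alpha>) \<partial>noise_space \<alpha> \<nu>)"
proof -
  define h' where "h' = (\<lambda>(x, w :: real \<times> real \<times> real). \<integral>\<^sup>+r. h (x, fst w, r) \<partial>coin_law \<alpha>)"
  have h': "h' \<in> borel_measurable (N \<Otimes>\<^sub>M borel \<Otimes>\<^sub>M (borel :: real measure) \<Otimes>\<^sub>M (borel :: real measure))"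
    unfolding h'_def split_beta' by measurable
  have sec: "(\<lambda>w. h (F \<omega>, w)) \<in> borel_measurable (borel \<Otimes>\<^sub>M borel \<Otimes>\<^sub>M borel)"
    "(\<lambda>w. h' (F \<omega>, w)) \<in> borel_measurable (borel \<Otimes>\<^sub>M borel \<Otimes>\<^sub>M borel)" for \<omega>
    using measurable_space[OF F, of \<omega>] h'
    by (auto simp: space_noise_space intro!: measurable_compose[OF _ h] measurable_compose[OF _ h'])
  have "(\<integral>\<^sup>+\<omega>. h (F \<omega>, \<omega> n) \<partial>noise_space \<alpha> \<nu>) =
      (\<integral>\<^sup>+\<omega>. (\<integral>\<^sup>+w. h (F \<omega>, w) \<partial>noise_law \<alpha> \<nu>) \<partial>noise_space \<alpha> \<nu>)"
    by (rule nn_integral_fresh_noise[where F=F, OF F fresh h])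
  also have "\<dots> = (\<integral>\<^sup>+\<omega>. (\<integral>\<^sup>+w. h' (F \<omega>, w) \<partial>noise_law \<alpha> \<nu>) \<partial>noise_space \<alpha> \<nu>)"
    unfolding nn_integral_noise_law[OF sec(1)] nn_integral_noise_law[OF sec(2)]
    by (simp add: h'_def coin.emeasure_space_1)
  also have "\<dots> = (\<integral>\<^sup>+\<omega>. h' (F \<omega>, \<omega> n) \<partial>noise_space \<alpha> \<nu>)"
    by (rule nn_integral_fresh_noise[where F=F, OF F fresh h', symmetric])
  finally show ?thesis by (simp add: h'_def)
qed

text \<open>
  The Markov property, by induction on the number \<open>m\<close> of steps. One more step replaces \<open>f\<close> by its
  average \<open>f'\<close> over the kernel; the induction hypothesis applied to \<open>f'\<close> leaves
  \<open>(\<delta>\<^sub>x \<triangle> \<nu>\<^sup>m) \<triangle> \<nu>\<close>, and associativity turns this into \<open>\<delta>\<^sub>x \<triangle> \<nu>\<^sup>m\<^sup>+\<^sup>1\<close>. Arbitrary \<open>f\<close> are needed because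
  \<open>f'\<close> need not be an indicator even if \<open>f\<close> is.
\<close>

lemma nn_integral_kendall_path_past:
  assumes B [measurable]: "B \<in> sets (\<Pi>\<^sub>M i\<in>{..k}. borel)" and f: "f \<in> borel_measurable borel"
  shows "(\<integral>\<^sup>+\<omega>. indicator B (\<lambda>i\<in>{..k}. kendall_path \<alpha> i \<omega>) * f (kendall_path \<alpha> (k + m) \<omega>) \<partial>noise_space \<alpha> \<nu>) =
    (\<integral>\<^sup>+\<omega>. indicator B (\<lambda>i\<in>{..k}. kendall_path \<alpha> i \<omega>) *
       (\<integral>\<^sup>+z. f z \<partial>kendall_conv \<alpha> (return borel (kendall_path \<alpha> k \<omega>)) (kendall_power \<alpha> \<nu> m))
       \<partial>noise_space \<alpha> \<nu>)"
  using f
proof (induction m arbitrary: f)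
  case 0
  then show ?case
    by (simp add: kendall_conv_zero_right[OF \<alpha> prob_on_nonneg_return[OF kendall_path_nonneg]] nn_integral_return)
next
  case (Suc m)
  note Suc.prems [measurable]
  let ?past = "\<lambda>\<omega>. \<lambda>i\<in>{..k}. kendall_path \<alpha> i \<omega>"
  let ?S = "\<Pi>\<^sub>M i\<in>{..k}. (borel :: real measure)"
  define F where "F \<omega> = (?past \<omega>, kendall_path \<alpha> (k + m) \<omega>)" for \<omega>
  define f' where "f' x = (\<integral>\<^sup>+z. f z \<partial>kendall_conv \<alpha> (return borel x) \<nu>)" for x
  define h where "h = (\<lambda>(p, w). indicator B (fst p) * f (kendall_step \<alpha> (snd p) w))"
  have past [measurable]: "?past \<in> measurable (noise_space \<alpha> \<nu>) ?S"
    by (rule measurable_past) measurable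
  have F: "F \<in> measurable (noise_space \<alpha> \<nu>) (?S \<Otimes>\<^sub>M borel)"
    unfolding F_def by measurable
  have fresh: "F (fun_upd \<omega> (k + m) w) = F \<omega>" for \<omega> w
    unfolding F_def by (auto simp: kendall_path_fresh intro!: restrict_ext)
  have h: "h \<in> borel_measurable ((?S \<Otimes>\<^sub>M borel) \<Otimes>\<^sub>M borel \<Otimes>\<^sub>M borel \<Otimes>\<^sub>M borel)"
    unfolding h_def split_beta' by measurable
  have f': "f' \<in> borel_measurable borel"
    unfolding f'_def
    by (rule measurable_compose[OF measurable_prob_algebraD[OF measurable_kendall_kernel[OF \<alpha> \<nu>]]
          nn_integral_measurable_subprob_algebra[OF Suc.prems]])
  have "(\<integral>\<^sup>+\<omega>. indicator B (?past \<omega>) * f (kendall_path \<alpha> (k + Suc m) \<omega>) \<partial>noise_space \<alpha> \<nu>) =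
      (\<integral>\<^sup>+\<omega>. h (F \<omega>, \<omega> (k + m)) \<partial>noise_space \<alpha> \<nu>)"
    by (simp add: h_def F_def)
  also have "\<dots> = (\<integral>\<^sup>+\<omega>. (\<integral>\<^sup>+w. h (F \<omega>, w) \<partial>noise_law \<alpha> \<nu>) \<partial>noise_space \<alpha> \<nu>)"
    by (rule nn_integral_fresh_noise[where F=F, OF F fresh h])
  also have "\<dots> = (\<integral>\<^sup>+\<omega>. indicator B (?past \<omega>) * f' (kendall_path \<alpha> (k + m) \<omega>) \<partial>noise_space \<alpha> \<nu>)"
  proof (rule nn_integral_cong)
    fix \<omega>
    let ?x = "kendall_path \<alpha> (k + m) \<omega>"
    have "(\<lambda>w. f (kendall_step \<alpha> ?x w)) \<in> borel_measurable (noise_law \<alpha> \<nu>)"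
      unfolding sets_noise_law[OF \<nu>, THEN measurable_cong_sets[OF _ refl]] by measurable
    then show "(\<integral>\<^sup>+w. h (F \<omega>, w) \<partial>noise_law \<alpha> \<nu>) = indicator B (?past \<omega>) * f' ?x"
      by (simp add: h_def F_def f'_def nn_integral_cmult
          nn_integral_kendall_step[OF \<alpha> \<nu> kendall_path_nonneg Suc.prems])
  qed
  also have "\<dots> = (\<integral>\<^sup>+\<omega>. indicator B (?past \<omega>) *
      (\<integral>\<^sup>+x. f' x \<partial>kendall_conv \<alpha> (return borel (kendall_path \<alpha> k \<omega>)) (kendall_power \<alpha> \<nu> m)) \<partial>noise_space \<alpha> \<nu>)"
    by (rule Suc.IH[OF f'])
  also have "\<dots> = (\<integral>\<^sup>+\<omega>. indicator B (?past \<omega>) *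
      (\<integral>\<^sup>+x. f x \<partial>kendall_conv \<alpha> (return borel (kendall_path \<alpha> k \<omega>)) (kendall_power \<alpha> \<nu> (Suc m))) \<partial>noise_space \<alpha> \<nu>)"
  proof -
    have "(\<integral>\<^sup>+x. f' x \<partial>kendall_conv \<alpha> (return borel y) (kendall_power \<alpha> \<nu> m)) =
        (\<integral>\<^sup>+x. f x \<partial>kendall_conv \<alpha> (return borel y) (kendall_power \<alpha> \<nu> (Suc m)))" if y: "0 \<le> y" for y
    proof -
      note ry = prob_on_nonneg_return[OF y] and pm = prob_on_nonneg_kendall_power[OF \<alpha> \<nu>, of m]
      have "(\<integral>\<^sup>+x. f' x \<partial>kendall_conv \<alpha> (return borel y) (kendall_power \<alpha> \<nu> m)) =
          (\<integral>\<^sup>+x. f x \<partial>kendall_conv \<alpha> (kendall_conv \<alpha> (return borel y) (kendall_power \<alpha> \<nu> m)) \<nu>)"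
        unfolding f'_def
        by (rule nn_integral_kendall_conv_kernel[OF \<alpha> prob_on_nonneg_kendall_conv[OF \<alpha> ry pm] \<nu> Suc.prems, symmetric])
      then show ?thesis
        by (simp add: kendall_conv_assoc[OF \<alpha> ry pm \<nu>])
    qed
    then show ?thesis by (simp only: kendall_path_nonneg)
  qed
  finally show ?case .
qed

lemma kendall_random_walk_path: "kendall_random_walk \<alpha> \<nu> (noise_space \<alpha> \<nu>) (kendall_path \<alpha>)"
  unfolding kendall_random_walk_def
proof (intro conjI allI impI ballI)
  fix k n :: nat and A :: "real set"
  assume kn: "k < n" and A [measurable]: "A \<in> sets borel"
  let ?past = "\<lambda>\<omega>. \<lambda>i\<in>{..k}. kendall_path \<alpha> i \<omega>"
  let ?S = "\<Pi>\<^sub>M i\<in>{..k}. (borel :: real measure)"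
  let ?\<mu> = "kendall_power \<alpha> \<nu> (n - k)"
  let ?g = "\<lambda>p. measure (kendall_conv \<alpha> (return borel (p k)) ?\<mu>) A"
  note pow = prob_on_nonneg_kendall_power[OF \<alpha> \<nu>, of "n - k"]
  note bounds = measure_kendall_kernel_bounds[OF \<alpha> pow]
  have past: "?past \<in> measurable (noise_space \<alpha> \<nu>) ?S"
    by (rule measurable_past) measurable
  have "(\<lambda>p. p k) \<in> borel_measurable ?S"
    by (rule measurable_component_singleton) simp
  then have g: "?g \<in> borel_measurable ?S"
    by (rule measurable_compose) (rule bounds)
  have "AE \<omega> in noise_space \<alpha> \<nu>.
      cond_prob_given (noise_space \<alpha> \<nu>) {\<omega>'\<in>space (noise_space \<alpha> \<nu>). kendall_path \<alpha> n \<omega>' \<in> A} ?S ?past \<omega> =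
      ?g (?past \<omega>)"
  proof (rule cond_prob_given_eqI[OF M.prob_space_axioms past _ g])
    fix B assume B [measurable]: "B \<in> sets ?S"
    note past [measurable]
    have "emeasure (noise_space \<alpha> \<nu>)
        (?past -` B \<inter> space (noise_space \<alpha> \<nu>) \<inter> {\<omega>'\<in>space (noise_space \<alpha> \<nu>). kendall_path \<alpha> n \<omega>' \<in> A}) =
        (\<integral>\<^sup>+\<omega>. indicator (?past -` B \<inter> space (noise_space \<alpha> \<nu>) \<inter>
           {\<omega>'\<in>space (noise_space \<alpha> \<nu>). kendall_path \<alpha> n \<omega>' \<in> A}) \<omega> \<partial>noise_space \<alpha> \<nu>)"
      by (intro nn_integral_indicator[symmetric]) measurable
    also have "\<dots> = (\<integral>\<^sup>+\<omega>. indicator B (?past \<omega>) * indicator A (kendall_path \<alpha> (k + (n - k)) \<omega>) \<partial>noise_space \<alpha> \<nu>)"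
      using kn by (intro nn_integral_cong) (auto simp: space_noise_space split: split_indicator)
    also have "\<dots> = (\<integral>\<^sup>+\<omega>. indicator B (?past \<omega>) *
       (\<integral>\<^sup>+z. indicator A z \<partial>kendall_conv \<alpha> (return borel (kendall_path \<alpha> k \<omega>)) ?\<mu>) \<partial>noise_space \<alpha> \<nu>)"
      by (rule nn_integral_kendall_path_past[OF B]) measurable
    also have "\<dots> = (\<integral>\<^sup>+\<omega>. ennreal (?g (?past \<omega>)) * indicator B (?past \<omega>) \<partial>noise_space \<alpha> \<nu>)"
    proof (rule nn_integral_cong)
      fix \<omega>
      have "A \<in> sets (kendall_conv \<alpha> (return borel (kendall_path \<alpha> k \<omega>)) ?\<mu>)"
        using prob_on_nonneg_kendall_conv[OF \<alpha> prob_on_nonneg_return[OF kendall_path_nonneg] pow] A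
        by (simp add: prob_on_nonneg_def)
      then show "indicator B (?past \<omega>) *
          (\<integral>\<^sup>+z. indicator A z \<partial>kendall_conv \<alpha> (return borel (kendall_path \<alpha> k \<omega>)) ?\<mu>) =
          ennreal (?g (?past \<omega>)) * indicator B (?past \<omega>)"
        by (simp add: bounds(3) mult.commute)
    qed
    finally show "emeasure (noise_space \<alpha> \<nu>)
        (?past -` B \<inter> space (noise_space \<alpha> \<nu>) \<inter> {\<omega>'\<in>space (noise_space \<alpha> \<nu>). kendall_path \<alpha> n \<omega>' \<in> A}) = \<dots>" .
  next
    show "{\<omega>'\<in>space (noise_space \<alpha> \<nu>). kendall_path \<alpha> n \<omega>' \<in> A} \<in> sets (noise_space \<alpha> \<nu>)"
      by measurable
  qed (use bounds(2) in simp_all)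
  then show "AE \<omega> in noise_space \<alpha> \<nu>.
      cond_prob_given (noise_space \<alpha> \<nu>) {\<omega>'\<in>space (noise_space \<alpha> \<nu>). kendall_path \<alpha> n \<omega>' \<in> A} ?S ?past \<omega> =
      measure (kendall_conv \<alpha> (return borel (kendall_path \<alpha> k \<omega>)) ?\<mu>) A"
    by simp
qed (simp_all add: M.prob_space_axioms kendall_path_nonneg)

text \<open>
  A common form of the three conditional distributions of the theorem: the event may depend on
  \<open>(X\<^sub>n, \<Delta>X\<^sub>n\<^sub>+\<^sub>1, \<theta>\<^sub>n)\<close> in one way if \<open>Q\<^sub>n = 1\<close> and in another way if \<open>Q\<^sub>n = 0\<close>. Constant predicates
  give the law of \<open>Q\<^sub>n\<close>, and the two branches of the recursion give the law of \<open>X\<^sub>n\<^sub>+\<^sub>1\<close>.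
\<close>

lemma cond_prob_given_switch:
  fixes P1 P0 :: "real \<Rightarrow> real \<Rightarrow> real \<Rightarrow> bool"
  assumes P1 [measurable]: "Measurable.pred (borel \<Otimes>\<^sub>M borel \<Otimes>\<^sub>M borel) (\<lambda>q. P1 (fst q) (fst (snd q)) (snd (snd q)))"
    and P0 [measurable]: "Measurable.pred (borel \<Otimes>\<^sub>M borel \<Otimes>\<^sub>M borel) (\<lambda>q. P0 (fst q) (fst (snd q)) (snd (snd q)))"
  shows "AE \<omega> in noise_space \<alpha> \<nu>.
    cond_prob_given (noise_space \<alpha> \<nu>)
      {\<omega>'\<in>space (noise_space \<alpha> \<nu>).
         if switch \<alpha> n \<omega>' = 1 then P1 (kendall_path \<alpha> n \<omega>') (increment (n + 1) \<omega>') (pareto_factor n \<omega>')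
         else P0 (kendall_path \<alpha> n \<omega>') (increment (n + 1) \<omega>') (pareto_factor n \<omega>')}
      (borel \<Otimes>\<^sub>M borel) (\<lambda>\<omega>'. (kendall_path \<alpha> n \<omega>', increment (n + 1) \<omega>')) \<omega> =
    (let x = kendall_path \<alpha> n \<omega>; y = increment (n + 1) \<omega>; p = kendall_z x y powr \<alpha> in
     p * measure (pareto (2 * \<alpha>)) {t. P1 x y t} + (1 - p) * measure (pareto (2 * \<alpha>)) {t. P0 x y t})"
proof -
  interpret P: prob_space "pareto (2 * \<alpha>)" using \<alpha> by (intro prob_space_pareto) simp
  note sets_pareto [measurable_cong]
  let ?\<Omega> = "noise_space \<alpha> \<nu>" and ?X = "kendall_path \<alpha> n" and ?D = "increment (n + 1)"
  let ?E = "{\<omega>'\<in>space ?\<Omega>. if switch \<alpha> n \<omega>' = 1 then P1 (?X \<omega>') (?D \<omega>') (pareto_factor n \<omega>')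
      else P0 (?X \<omega>') (?D \<omega>') (pareto_factor n \<omega>')}"
  \<comment> \<open>measurability in \<open>(x, y)\<close> is available for integrals, so the section measures are written as integrals\<close>
  define m where "m P x y = (\<integral>\<^sup>+t. (if P x y t then 1 else 0) \<partial>pareto (2 * \<alpha>))"
    for P :: "real \<Rightarrow> real \<Rightarrow> real \<Rightarrow> bool" and x y
  have m: "m P x y = ennreal (measure (pareto (2 * \<alpha>)) {t. P x y t})"
    if P [measurable]: "Measurable.pred (borel \<Otimes>\<^sub>M borel \<Otimes>\<^sub>M borel) (\<lambda>q. P (fst q) (fst (snd q)) (snd (snd q)))"
    for P x y
  proof -
    have "Measurable.pred borel (\<lambda>t. P x y t)"
      using measurable_compose[OF _ P, of "\<lambda>t. (x, y, t)" borel] by simp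
    then have [measurable]: "{t. P x y t} \<in> sets (pareto (2 * \<alpha>))"
      by (simp add: sets_pareto pred_def)
    have "m P x y = (\<integral>\<^sup>+t. indicator {t. P x y t} t \<partial>pareto (2 * \<alpha>))"
      unfolding m_def by (intro nn_integral_cong) (simp add: indicator_def)
    then show ?thesis by (simp add: P.emeasure_eq_measure)
  qed
  define G where "G = (\<lambda>(x, y). let p = kendall_z x y powr \<alpha> in
     p * measure (pareto (2 * \<alpha>)) {t. P1 x y t} + (1 - p) * measure (pareto (2 * \<alpha>)) {t. P0 x y t})"
  have meas: "measure (pareto (2 * \<alpha>)) {t. P x y t} = enn2real (m P x y)"
    if "Measurable.pred (borel \<Otimes>\<^sub>M borel \<Otimes>\<^sub>M borel) (\<lambda>q. P (fst q) (fst (snd q)) (snd (snd q)))" for P x y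
    by (simp add: m[OF that])
  have m_measurable: "(\<lambda>q. m P (fst q) (snd q)) \<in> borel_measurable (borel \<Otimes>\<^sub>M borel)"
    if P: "Measurable.pred (borel \<Otimes>\<^sub>M borel \<Otimes>\<^sub>M borel) (\<lambda>q. P (fst q) (fst (snd q)) (snd (snd q)))" for P
  proof -
    have [measurable]: "Measurable.pred ((borel \<Otimes>\<^sub>M borel) \<Otimes>\<^sub>M borel) (\<lambda>x. P (fst (fst x)) (snd (fst x)) (snd x))"
      using measurable_compose[OF _ P, of "\<lambda>x. (fst (fst x), snd (fst x), snd x)" "(borel \<Otimes>\<^sub>M borel) \<Otimes>\<^sub>M borel"]
      by simp
    show ?thesis unfolding m_def by measurable
  qed
  note m_measurable[OF P1, measurable] m_measurable[OF P0, measurable]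
  have G: "G \<in> borel_measurable (borel \<Otimes>\<^sub>M borel)"
    unfolding G_def split_beta' Let_def meas[OF P1] meas[OF P0] by measurable
  have Gbounds: "0 \<le> G (x, y) \<and> G (x, y) \<le> 1" if "0 \<le> x" "0 \<le> y" for x y
    using kendall_z_powr_bounds[OF \<alpha> that] unfolding G_def Let_def
    by (auto intro!: convex_bound_le add_nonneg_nonneg mult_nonneg_nonneg)
  have Y: "(\<lambda>\<omega>'. (?X \<omega>', ?D \<omega>')) \<in> measurable ?\<Omega> (borel \<Otimes>\<^sub>M borel)"
    by measurable
  have sw: "switch \<alpha> n \<omega> = 1 \<longleftrightarrow> snd (snd (\<omega> n)) < kendall_z (?X \<omega>) (?D \<omega>) powr \<alpha>" for \<omega>
    by (simp add: switch_def)
  have E: "?E \<in> sets ?\<Omega>"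
  proof -
    have XDT: "(\<lambda>\<omega>. (?X \<omega>, ?D \<omega>, pareto_factor n \<omega>)) \<in> measurable ?\<Omega> (borel \<Otimes>\<^sub>M borel \<Otimes>\<^sub>M borel)"
      by measurable
    have [measurable]: "Measurable.pred ?\<Omega> (\<lambda>\<omega>. P1 (?X \<omega>) (?D \<omega>) (pareto_factor n \<omega>))"
      "Measurable.pred ?\<Omega> (\<lambda>\<omega>. P0 (?X \<omega>) (?D \<omega>) (pareto_factor n \<omega>))"
      using measurable_compose[OF XDT P1] measurable_compose[OF XDT P0] by simp_all
    show ?thesis unfolding sw by measurable
  qed
  have "AE \<omega> in ?\<Omega>. cond_prob_given ?\<Omega> ?E (borel \<Otimes>\<^sub>M borel) (\<lambda>\<omega>'. (?X \<omega>', ?D \<omega>')) \<omega> = G (?X \<omega>, ?D \<omega>)"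
  proof (rule cond_prob_given_eqI[OF M.prob_space_axioms Y E G])
    fix B :: "(real \<times> real) set" assume B [measurable]: "B \<in> sets (borel \<Otimes>\<^sub>M borel)"
    define h where "h = (\<lambda>(x, y, t, u).
      if (x, \<bar>y\<bar>) \<in> B then
        if u < kendall_z x \<bar>y\<bar> powr \<alpha> then if P1 x \<bar>y\<bar> \<bar>t\<bar> then 1 else 0
        else if P0 x \<bar>y\<bar> \<bar>t\<bar> then 1 else 0
      else (0 :: ennreal))"
    have h: "h \<in> borel_measurable (borel \<Otimes>\<^sub>M borel \<Otimes>\<^sub>M borel \<Otimes>\<^sub>M borel)"
    proof -
      have T: "(\<lambda>q. (fst q, \<bar>fst (snd q)\<bar>, \<bar>fst (snd (snd q))\<bar>)) \<in>
          measurable (borel \<Otimes>\<^sub>M borel \<Otimes>\<^sub>M borel \<Otimes>\<^sub>M (borel :: real measure))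
            (borel \<Otimes>\<^sub>M (borel :: real measure) \<Otimes>\<^sub>M (borel :: real measure))"
        by measurable
      have [measurable]:
        "Measurable.pred (borel \<Otimes>\<^sub>M borel \<Otimes>\<^sub>M borel \<Otimes>\<^sub>M (borel :: real measure))
          (\<lambda>q. P1 (fst q) \<bar>fst (snd q)\<bar> \<bar>fst (snd (snd q))\<bar>)"
        "Measurable.pred (borel \<Otimes>\<^sub>M borel \<Otimes>\<^sub>M borel \<Otimes>\<^sub>M (borel :: real measure))
          (\<lambda>q. P0 (fst q) \<bar>fst (snd q)\<bar> \<bar>fst (snd (snd q))\<bar>)"
        using measurable_compose[OF T P1] measurable_compose[OF T P0] by simp_all
      show ?thesis
        unfolding h_def split_beta' by measurable
    qed
    have coin: "(\<integral>\<^sup>+r. h (x, y, r) \<partial>coin_law \<alpha>) = ennreal (G (x, \<bar>y\<bar>)) * indicator B (x, \<bar>y\<bar>)" if x: "0 \<le> x" for x y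
    proof (cases "(x, \<bar>y\<bar>) \<in> B")
      case True
      define p where "p = kendall_z x \<bar>y\<bar> powr \<alpha>"
      have p: "0 \<le> p" "p \<le> 1"
        using kendall_z_powr_bounds[OF \<alpha> x, of "\<bar>y\<bar>"] by (simp_all add: p_def)
      have sec: "(\<lambda>t. if P1 x \<bar>y\<bar> t then 1 else 0 :: ennreal) \<in> borel_measurable borel"
        "(\<lambda>t. if P0 x \<bar>y\<bar> t then 1 else 0 :: ennreal) \<in> borel_measurable borel"
        using measurable_compose[OF _ P1, of "\<lambda>t. (x, \<bar>y\<bar>, t)" borel]
          measurable_compose[OF _ P0, of "\<lambda>t. (x, \<bar>y\<bar>, t)" borel] by simp_all
      have "(\<integral>\<^sup>+r. h (x, y, r) \<partial>coin_law \<alpha>) = ennreal p * m P1 x \<bar>y\<bar> + ennreal (1 - p) * m P0 x \<bar>y\<bar>"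
        unfolding m_def nn_integral_coin_law[OF \<alpha> p sec, symmetric]
        using True by (intro nn_integral_cong) (simp add: h_def p_def split_beta')
      also have "\<dots> = ennreal (G (x, \<bar>y\<bar>))"
        using p unfolding m[OF P1] m[OF P0] G_def
        by (simp add: Let_def ennreal_plus ennreal_mult flip: p_def)
      finally show ?thesis using True by simp
    qed (simp add: h_def split_beta')
    have "emeasure ?\<Omega> ((\<lambda>\<omega>'. (?X \<omega>', ?D \<omega>')) -` B \<inter> space ?\<Omega> \<inter> ?E) =
        (\<integral>\<^sup>+\<omega>. indicator ((\<lambda>\<omega>'. (?X \<omega>', ?D \<omega>')) -` B \<inter> space ?\<Omega> \<inter> ?E) \<omega> \<partial>?\<Omega>)"
      by (rule nn_integral_indicator[symmetric, OF sets.Int[OF measurable_sets[OF Y B] E]])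
    also have "\<dots> = (\<integral>\<^sup>+\<omega>. h (?X \<omega>, \<omega> n) \<partial>?\<Omega>)"
      by (intro nn_integral_cong)
        (auto simp: h_def split_beta' space_noise_space increment_Suc switch_def pareto_factor_def split: split_indicator)
    also have "\<dots> = (\<integral>\<^sup>+\<omega>. (\<integral>\<^sup>+r. h (?X \<omega>, fst (\<omega> n), r) \<partial>coin_law \<alpha>) \<partial>?\<Omega>)"
      by (rule nn_integral_fresh_coin[where F="kendall_path \<alpha> n", OF measurable_kendall_path kendall_path_fresh[OF order_refl] h])
    also have "\<dots> = (\<integral>\<^sup>+\<omega>. ennreal (G (?X \<omega>, ?D \<omega>)) * indicator B (?X \<omega>, ?D \<omega>) \<partial>?\<Omega>)"
      by (simp add: coin kendall_path_nonneg increment_Suc)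
    finally show "emeasure ?\<Omega> ((\<lambda>\<omega>'. (?X \<omega>', ?D \<omega>')) -` B \<inter> space ?\<Omega> \<inter> ?E) = \<dots>" .
  qed (simp add: Gbounds kendall_path_nonneg increment_Suc)
  then show ?thesis by (simp add: G_def Let_def)
qed

lemma distr_fst_noise: "distr (noise_space \<alpha> \<nu>) borel (\<lambda>\<omega>. \<bar>fst (\<omega> n)\<bar>) = \<nu>"
proof (rule measure_eqI)
  show sets: "sets (distr (noise_space \<alpha> \<nu>) borel (\<lambda>\<omega>. \<bar>fst (\<omega> n)\<bar>)) = sets \<nu>"
    using \<nu> by (simp add: prob_on_nonneg_def)
  fix A assume "A \<in> sets (distr (noise_space \<alpha> \<nu>) borel (\<lambda>\<omega>. \<bar>fst (\<omega> n)\<bar>))"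
  then have A [measurable]: "A \<in> sets borel" by simp
  \<comment> \<open>the trivial variable \<open>()\<close> ignores every coordinate, which yields the marginal law\<close>
  have h: "(\<lambda>(q, w). indicator A \<bar>fst w\<bar> :: ennreal) \<in>
      borel_measurable (count_space {()} \<Otimes>\<^sub>M borel \<Otimes>\<^sub>M (borel :: real measure) \<Otimes>\<^sub>M (borel :: real measure))"
    unfolding split_beta' by measurable
  have "emeasure (distr (noise_space \<alpha> \<nu>) borel (\<lambda>\<omega>. \<bar>fst (\<omega> n)\<bar>)) A =
      (\<integral>\<^sup>+z. indicator A z \<partial>distr (noise_space \<alpha> \<nu>) borel (\<lambda>\<omega>. \<bar>fst (\<omega> n)\<bar>))"
    by simp
  also have "\<dots> = (\<integral>\<^sup>+\<omega>. indicator A \<bar>fst (\<omega> n)\<bar> \<partial>noise_space \<alpha> \<nu>)"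
    by (rule nn_integral_distr) measurable
  also have "\<dots> = (\<integral>\<^sup>+w. indicator A \<bar>fst w\<bar> \<partial>noise_law \<alpha> \<nu>)"
    using nn_integral_fresh_noise[of "\<lambda>_. ()" "count_space {()}" n, OF _ _ h]
    by (simp add: M.emeasure_space_1)
  also have "\<dots> = (\<integral>\<^sup>+y. indicator A \<bar>y\<bar> \<partial>\<nu>)"
    by (subst nn_integral_noise_law) (simp_all add: coin.emeasure_space_1)
  also have "\<dots> = (\<integral>\<^sup>+y. indicator A y \<partial>\<nu>)"
    using AE_nonneg_prob_on_nonneg[OF \<nu>] by (intro nn_integral_cong_AE) (auto elim!: eventually_mono)
  also have "\<dots> = emeasure \<nu> A"
    using A \<nu> by (simp add: prob_on_nonneg_def)
  finally show "emeasure (distr (noise_space \<alpha> \<nu>) borel (\<lambda>\<omega>. \<bar>fst (\<omega> n)\<bar>)) A = emeasure \<nu> A" .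
qed

lemma distr_pareto_factor: "distr (noise_space \<alpha> \<nu>) borel (pareto_factor n) = pareto (2 * \<alpha>)"
proof (rule measure_eqI)
  fix A assume "A \<in> sets (distr (noise_space \<alpha> \<nu>) borel (pareto_factor n))"
  then have A [measurable]: "A \<in> sets borel" by simp
  have h: "(\<lambda>(q, w). indicator A \<bar>fst (snd w)\<bar> :: ennreal) \<in>
      borel_measurable (count_space {()} \<Otimes>\<^sub>M (borel :: real measure) \<Otimes>\<^sub>M borel \<Otimes>\<^sub>M (borel :: real measure))"
    unfolding split_beta' by measurable
  have "emeasure (distr (noise_space \<alpha> \<nu>) borel (pareto_factor n)) A =
      (\<integral>\<^sup>+z. indicator A z \<partial>distr (noise_space \<alpha> \<nu>) borel (pareto_factor n))"
    by simp
  also have "\<dots> = (\<integral>\<^sup>+\<omega>. indicator A (pareto_factor n \<omega>) \<partial>noise_space \<alpha> \<nu>)"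
    by (rule nn_integral_distr) measurable
  also have "\<dots> = (\<integral>\<^sup>+r. indicator A \<bar>fst r\<bar> \<partial>coin_law \<alpha>)"
    using nn_integral_fresh_coin[of "\<lambda>_. ()" "count_space {()}" n, OF _ _ h]
    by (simp add: M.emeasure_space_1 pareto_factor_def)
  also have "\<dots> = (\<integral>\<^sup>+r. (if snd r < 1 then indicator A \<bar>fst r\<bar> else indicator A \<bar>fst r\<bar>) \<partial>coin_law \<alpha>)"
    by simp
  also have "\<dots> = (\<integral>\<^sup>+t. indicator A t \<partial>pareto (2 * \<alpha>))"
    by (subst nn_integral_coin_law[OF \<alpha>]) simp_all
  also have "\<dots> = emeasure (pareto (2 * \<alpha>)) A"
    by (simp add: sets_pareto)
  finally show "emeasure (distr (noise_space \<alpha> \<nu>) borel (pareto_factor n)) A = emeasure (pareto (2 * \<alpha>)) A" .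
qed (simp add: sets_pareto)

lemma indep_vars_noise:
  assumes r: "inj_on r I" and I: "I \<noteq> {}"
    and G: "G \<in> borel_measurable (borel \<Otimes>\<^sub>M borel \<Otimes>\<^sub>M borel)"
  shows "M.indep_vars (\<lambda>_. borel) (\<lambda>i \<omega>. G (\<omega> (r i))) (I :: nat set)"
proof -
  let ?P = "noise_law \<alpha> \<nu>"
  have coord: "distr (noise_space \<alpha> \<nu>) ?P (\<lambda>\<omega>. \<omega> (r i)) = ?P" for i
    unfolding noise_space_def by (intro distr_PiM_component prob_space_noise_law \<alpha> \<nu>) simp
  have "M.indep_vars (\<lambda>_. ?P) (\<lambda>i \<omega>. \<omega> (r i)) I"
  proof (subst M.indep_vars_iff_distr_eq_PiM'[OF I])
    show "(\<lambda>\<omega>. \<omega> (r i)) \<in> measurable (noise_space \<alpha> \<nu>) ?P" for i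
      unfolding noise_space_def by (rule measurable_component_singleton) simp
    show "distr (noise_space \<alpha> \<nu>) (\<Pi>\<^sub>M i\<in>I. ?P) (\<lambda>\<omega>. \<lambda>i\<in>I. \<omega> (r i)) =
        (\<Pi>\<^sub>M i\<in>I. distr (noise_space \<alpha> \<nu>) ?P (\<lambda>\<omega>. \<omega> (r i)))"
      unfolding coord unfolding noise_space_def
      by (intro distr_PiM_reindex prob_space_noise_law \<alpha> \<nu> r) simp
  qed
  then show ?thesis
    by (rule M.indep_vars_compose2) (use G in \<open>simp add: measurable_cong_sets[OF sets_noise_law[OF \<nu>] refl]\<close>)
qed

lemma indep_rv_increment_path:
  "indep_rv (noise_space \<alpha> \<nu>) borel (increment (n + 1)) borel (kendall_path \<alpha> n)"
proof (rule indep_rvI[OF M.prob_space_axioms])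
  let ?\<Omega> = "noise_space \<alpha> \<nu>"
  fix A B :: "real set" assume A [measurable]: "A \<in> sets borel" and B [measurable]: "B \<in> sets borel"
  \<comment> \<open>\<open>c\<close> is the probability of the first event; taking \<open>B' = UNIV\<close> in the joint formula shows this\<close>
  define c where "c = (\<integral>\<^sup>+w. indicator A \<bar>fst w\<bar> \<partial>noise_law \<alpha> \<nu>)"
  have joint: "emeasure ?\<Omega> {\<omega>\<in>space ?\<Omega>. increment (n + 1) \<omega> \<in> A \<and> kendall_path \<alpha> n \<omega> \<in> B'} =
      c * emeasure ?\<Omega> {\<omega>\<in>space ?\<Omega>. kendall_path \<alpha> n \<omega> \<in> B'}"
    if B' [measurable]: "B' \<in> sets borel" for B'
  proof -
    have h: "(\<lambda>(x, w). indicator B' x * indicator A \<bar>fst w\<bar> :: ennreal) \<in>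
        borel_measurable (borel \<Otimes>\<^sub>M borel \<Otimes>\<^sub>M (borel :: real measure) \<Otimes>\<^sub>M (borel :: real measure))"
      unfolding split_beta' by measurable
    have Aw: "(\<lambda>w. indicator A \<bar>fst w\<bar>) \<in> borel_measurable (noise_law \<alpha> \<nu>)"
      unfolding measurable_cong_sets[OF sets_noise_law[OF \<nu>] refl] by measurable
    have inner: "(\<integral>\<^sup>+w. d * indicator A \<bar>fst w\<bar> \<partial>noise_law \<alpha> \<nu>) = c * d" for d
      unfolding nn_integral_cmult[OF Aw] c_def by (rule mult.commute)
    have "emeasure ?\<Omega> {\<omega>\<in>space ?\<Omega>. increment (n + 1) \<omega> \<in> A \<and> kendall_path \<alpha> n \<omega> \<in> B'} =
        (\<integral>\<^sup>+\<omega>. indicator {\<omega>\<in>space ?\<Omega>. increment (n + 1) \<omega> \<in> A \<and> kendall_path \<alpha> n \<omega> \<in> B'} \<omega> \<partial>?\<Omega>)"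
      by (intro nn_integral_indicator[symmetric]) measurable
    also have "\<dots> = (\<integral>\<^sup>+\<omega>. indicator B' (kendall_path \<alpha> n \<omega>) * indicator A \<bar>fst (\<omega> n)\<bar> \<partial>?\<Omega>)"
      by (intro nn_integral_cong) (auto simp: increment_Suc space_noise_space split: split_indicator)
    also have "\<dots> = (\<integral>\<^sup>+\<omega>. c * indicator B' (kendall_path \<alpha> n \<omega>) \<partial>?\<Omega>)"
      using nn_integral_fresh_noise[where F="kendall_path \<alpha> n", OF measurable_kendall_path kendall_path_fresh[OF order_refl] h]
      by (simp add: inner)
    also have "\<dots> = c * (\<integral>\<^sup>+\<omega>. indicator {\<omega>\<in>space ?\<Omega>. kendall_path \<alpha> n \<omega> \<in> B'} \<omega> \<partial>?\<Omega>)"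
      by (subst nn_integral_cmult) (auto intro!: arg_cong2[where f="(*)"] nn_integral_cong simp: space_noise_space split: split_indicator)
    also have "\<dots> = c * emeasure ?\<Omega> {\<omega>\<in>space ?\<Omega>. kendall_path \<alpha> n \<omega> \<in> B'}"
      by (subst nn_integral_indicator) simp_all
    finally show ?thesis .
  qed
  have "emeasure ?\<Omega> {\<omega>\<in>space ?\<Omega>. increment (n + 1) \<omega> \<in> A} = c"
    using joint[of UNIV] by (simp add: M.emeasure_space_1)
  with joint[OF B] show "emeasure ?\<Omega> {\<omega>\<in>space ?\<Omega>. increment (n + 1) \<omega> \<in> A \<and> kendall_path \<alpha> n \<omega> \<in> B} =
      emeasure ?\<Omega> {\<omega>\<in>space ?\<Omega>. increment (n + 1) \<omega> \<in> A} * emeasure ?\<Omega> {\<omega>\<in>space ?\<Omega>. kendall_path \<alpha> n \<omega> \<in> B}"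
    by simp
qed measurable

lemma indep_rv_pareto_factor:
  "indep_rv (noise_space \<alpha> \<nu>) borel (pareto_factor n) (borel \<Otimes>\<^sub>M borel)
     (\<lambda>\<omega>. (kendall_path \<alpha> n \<omega>, increment (n + 1) \<omega>))"
proof (rule indep_rvI[OF M.prob_space_axioms])
  let ?\<Omega> = "noise_space \<alpha> \<nu>" and ?Y = "\<lambda>\<omega>. (kendall_path \<alpha> n \<omega>, increment (n + 1) \<omega>)"
  fix A :: "real set" and B :: "(real \<times> real) set"
  assume A [measurable]: "A \<in> sets borel" and B [measurable]: "B \<in> sets (borel \<Otimes>\<^sub>M borel)"
  define c where "c = (\<integral>\<^sup>+r. indicator A \<bar>fst r\<bar> \<partial>coin_law \<alpha>)"
  have joint: "emeasure ?\<Omega> {\<omega>\<in>space ?\<Omega>. pareto_factor n \<omega> \<in> A \<and> ?Y \<omega> \<in> B'} =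
      c * emeasure ?\<Omega> {\<omega>\<in>space ?\<Omega>. ?Y \<omega> \<in> B'}"
    if B' [measurable]: "B' \<in> sets (borel \<Otimes>\<^sub>M borel)" for B'
  proof -
    have h: "(\<lambda>(x, w). indicator B' (x, \<bar>fst w\<bar>) * indicator A \<bar>fst (snd w)\<bar> :: ennreal) \<in>
        borel_measurable (borel \<Otimes>\<^sub>M borel \<Otimes>\<^sub>M borel \<Otimes>\<^sub>M (borel :: real measure))"
      unfolding split_beta' by measurable
    have Ar: "(\<lambda>r. indicator A \<bar>fst r\<bar>) \<in> borel_measurable (coin_law \<alpha>)"
      by measurable
    have inner: "(\<integral>\<^sup>+r. d * indicator A \<bar>fst r\<bar> \<partial>coin_law \<alpha>) = c * d" for d
      unfolding nn_integral_cmult[OF Ar] c_def by (rule mult.commute)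
    have "emeasure ?\<Omega> {\<omega>\<in>space ?\<Omega>. pareto_factor n \<omega> \<in> A \<and> ?Y \<omega> \<in> B'} =
        (\<integral>\<^sup>+\<omega>. indicator {\<omega>\<in>space ?\<Omega>. pareto_factor n \<omega> \<in> A \<and> ?Y \<omega> \<in> B'} \<omega> \<partial>?\<Omega>)"
      by (intro nn_integral_indicator[symmetric]) measurable
    also have "\<dots> = (\<integral>\<^sup>+\<omega>. indicator B' (kendall_path \<alpha> n \<omega>, \<bar>fst (\<omega> n)\<bar>) * indicator A \<bar>fst (snd (\<omega> n))\<bar> \<partial>?\<Omega>)"
      by (intro nn_integral_cong) (auto simp: increment_Suc pareto_factor_def space_noise_space split: split_indicator)
    also have "\<dots> = (\<integral>\<^sup>+\<omega>. c * indicator B' (?Y \<omega>) \<partial>?\<Omega>)"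
      using nn_integral_fresh_coin[where F="kendall_path \<alpha> n", OF measurable_kendall_path kendall_path_fresh[OF order_refl] h]
      by (simp add: inner increment_Suc)
    also have "\<dots> = c * (\<integral>\<^sup>+\<omega>. indicator {\<omega>\<in>space ?\<Omega>. ?Y \<omega> \<in> B'} \<omega> \<partial>?\<Omega>)"
      by (subst nn_integral_cmult) (auto intro!: arg_cong2[where f="(*)"] nn_integral_cong simp: space_noise_space split: split_indicator)
    also have "\<dots> = c * emeasure ?\<Omega> {\<omega>\<in>space ?\<Omega>. ?Y \<omega> \<in> B'}"
      by (subst nn_integral_indicator) simp_all
    finally show ?thesis .
  qed
  have "emeasure ?\<Omega> {\<omega>\<in>space ?\<Omega>. pareto_factor n \<omega> \<in> A} = c"
    using joint[OF sets.top] by (simp add: space_pair_measure M.emeasure_space_1)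
  with joint[OF B] show "emeasure ?\<Omega> {\<omega>\<in>space ?\<Omega>. pareto_factor n \<omega> \<in> A \<and> ?Y \<omega> \<in> B} =
      emeasure ?\<Omega> {\<omega>\<in>space ?\<Omega>. pareto_factor n \<omega> \<in> A} * emeasure ?\<Omega> {\<omega>\<in>space ?\<Omega>. ?Y \<omega> \<in> B}"
    by simp
qed measurable

text \<open>
  At the start \<open>z(0, y) = 0\<close>, so the switch fires only on the null event \<open>U\<^sub>0 < 0\<close>.
\<close>

lemma kendall_path_1: "AE \<omega> in noise_space \<alpha> \<nu>. kendall_path \<alpha> 1 \<omega> = increment 1 \<omega>"
proof (rule AE_I)
  let ?\<Omega> = "noise_space \<alpha> \<nu>" and ?N = "{\<omega>\<in>space (noise_space \<alpha> \<nu>). snd (snd (\<omega> 0)) < 0}"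
  \<comment> \<open>the trivial variable \<open>()\<close> ignores every coordinate, which yields the marginal law\<close>
  have h: "(\<lambda>(q, w). if snd (snd w) < 0 then 1 else 0 :: ennreal) \<in>
      borel_measurable (count_space {()} \<Otimes>\<^sub>M (borel :: real measure) \<Otimes>\<^sub>M (borel :: real measure) \<Otimes>\<^sub>M (borel :: real measure))"
    unfolding split_beta' by measurable
  show N: "?N \<in> sets ?\<Omega>" by measurable
  then have "emeasure ?\<Omega> ?N = (\<integral>\<^sup>+\<omega>. indicator ?N \<omega> \<partial>?\<Omega>)"
    by (rule nn_integral_indicator[symmetric])
  also have "\<dots> = (\<integral>\<^sup>+\<omega>. (if snd (snd (\<omega> 0)) < 0 then 1 else 0) \<partial>?\<Omega>)"
    by (intro nn_integral_cong) (simp add: indicator_def space_noise_space)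
  also have "\<dots> = (\<integral>\<^sup>+r. (if snd r < 0 then 1 else 0) \<partial>coin_law \<alpha>)"
    using nn_integral_fresh_coin[of "\<lambda>_. ()" "count_space {()}" 0, OF _ _ h]
    by (simp add: M.emeasure_space_1)
  also have "\<dots> = 0"
    using nn_integral_coin_law[OF \<alpha>, of 0 "\<lambda>_. 1" "\<lambda>_. 0"] by simp
  finally show "emeasure ?\<Omega> ?N = 0" .
  show "{\<omega>\<in>space ?\<Omega>. kendall_path \<alpha> 1 \<omega> \<noteq> increment 1 \<omega>} \<subseteq> ?N"
    by (auto simp: kendall_step_def increment_def kendall_z_def Let_def split: if_splits)
qed

end

theorem theorem3p6:
  fixes \<alpha> :: real and \<nu> :: "real measure"
  assumes "\<alpha> > 0"
    and "prob_on_nonneg \<nu>"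
  shows "\<exists>(M :: (nat \<Rightarrow> real \<times> real \<times> real) measure) X \<Delta>X \<theta> (Q :: nat \<Rightarrow> _ \<Rightarrow> nat).
    \<comment> \<open>the Kendall random walk, which is unique in law\<close>
    kendall_random_walk \<alpha> \<nu> M X \<and>
    (\<forall>(M' :: 'w measure) X'. kendall_random_walk \<alpha> \<nu> M' X' \<longrightarrow> path_law M' X' = path_law M X) \<and>
    \<comment> \<open>the driving random variables\<close>
    prob_space.indep_vars M (\<lambda>_. borel) \<Delta>X {1..} \<and>
    (\<forall>n\<ge>1. distr M borel (\<Delta>X n) = \<nu>) \<and>
    prob_space.indep_vars M (\<lambda>_. borel) \<theta> {1..} \<and>
    (\<forall>n\<ge>1. distr M borel (\<theta> n) = pareto (2 * \<alpha>)) \<and>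
    (\<forall>n\<ge>1. Q n \<in> measurable M (count_space UNIV) \<and> (\<forall>\<omega>\<in>space M. Q n \<omega> \<in> {0, 1})) \<and>
    \<comment> \<open>the recursion\<close>
    (AE \<omega> in M. X 0 \<omega> = 0) \<and>
    (AE \<omega> in M. X 1 \<omega> = \<Delta>X 1 \<omega>) \<and>
    (\<forall>n\<ge>1. AE \<omega> in M. X (n + 1) \<omega> = max (X n \<omega>) (\<Delta>X (n + 1) \<omega>) * \<theta> n \<omega> ^ Q n \<omega>) \<and>
    \<comment> \<open>independence\<close>
    (\<forall>n\<ge>1. prob_space.indep_var M borel (\<Delta>X (n + 1)) borel (X n)) \<and>
    (\<forall>n\<ge>1. indep_rv M borel (\<theta> n) (borel \<Otimes>\<^sub>M borel) (\<lambda>\<omega>. (X n \<omega>, \<Delta>X (n + 1) \<omega>))) \<and>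
    (\<forall>n\<ge>1. prob_space.indep_var M borel (\<theta> n) borel (\<lambda>\<omega>. max (X n \<omega>) (\<Delta>X (n + 1) \<omega>))) \<and>
    \<comment> \<open>the conditional distribution of \<open>Q n\<close>\<close>
    (\<forall>n\<ge>1. AE \<omega> in M.
       cond_prob_given M {\<omega>'\<in>space M. Q n \<omega>' = 1}
         (borel \<Otimes>\<^sub>M borel) (\<lambda>\<omega>'. (X n \<omega>', \<Delta>X (n + 1) \<omega>')) \<omega> =
       kendall_z (X n \<omega>) (\<Delta>X (n + 1) \<omega>) powr \<alpha>) \<and>
    (\<forall>n\<ge>1. AE \<omega> in M.
       cond_prob_given M {\<omega>'\<in>space M. Q n \<omega>' = 0}
         (borel \<Otimes>\<^sub>M borel) (\<lambda>\<omega>'. (X n \<omega>', \<Delta>X (n + 1) \<omega>')) \<omega> =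
       1 - kendall_z (X n \<omega>) (\<Delta>X (n + 1) \<omega>) powr \<alpha>) \<and>
    \<comment> \<open>the conditional distribution of \<open>X n\<close>\<close>
    (\<forall>n\<ge>2. \<forall>A\<in>sets borel. A \<subseteq> {0..} \<longrightarrow>
       (AE \<omega> in M.
          cond_prob_given M {\<omega>'\<in>space M. X n \<omega>' \<in> A}
            (borel \<Otimes>\<^sub>M borel) (\<lambda>\<omega>'. (X (n - 1) \<omega>', \<Delta>X n \<omega>')) \<omega> =
          (let z = kendall_z (X (n - 1) \<omega>) (\<Delta>X n \<omega>); v = kendall_v (X (n - 1) \<omega>) (\<Delta>X n \<omega>) in
           z powr \<alpha> * measure (pareto (2 * \<alpha>)) {t. v * t \<in> A} +
           (1 - z powr \<alpha>) * indicator A v)))"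
proof -
  note \<alpha> = assms(1) and \<nu> = assms(2)
  let ?\<Omega> = "noise_space \<alpha> \<nu>" and ?X = "kendall_path \<alpha>" and ?Q = "switch \<alpha>"
  have ps: "prob_space ?\<Omega>" by (rule prob_space_noise_space[OF \<alpha> \<nu>])
  note walk = kendall_random_walk_path[OF \<alpha> \<nu>]
  have indep_increment: "prob_space.indep_vars ?\<Omega> (\<lambda>_. borel) increment {1..}"
  proof -
    have inj: "inj_on (\<lambda>i::nat. i - 1) {1..}" by (auto simp: inj_on_def)
    have G: "(\<lambda>w :: real \<times> real \<times> real. \<bar>fst w\<bar>) \<in> borel_measurable (borel \<Otimes>\<^sub>M borel \<Otimes>\<^sub>M borel)" by measurable
    show ?thesis
      using indep_vars_noise[OF \<alpha> \<nu> inj _ G] by (simp add: increment_def[abs_def])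
  qed
  have indep_pareto: "prob_space.indep_vars ?\<Omega> (\<lambda>_. borel) pareto_factor {1..}"
  proof -
    have inj: "inj_on (\<lambda>i::nat. i) {1..}" by (auto simp: inj_on_def)
    have G: "(\<lambda>w :: real \<times> real \<times> real. \<bar>fst (snd w)\<bar>) \<in> borel_measurable (borel \<Otimes>\<^sub>M borel \<Otimes>\<^sub>M borel)" by measurable
    show ?thesis
      using indep_vars_noise[OF \<alpha> \<nu> inj _ G] by (simp add: pareto_factor_def[abs_def])
  qed
  have indep_max: "prob_space.indep_var ?\<Omega> borel (pareto_factor n) borel (\<lambda>\<omega>. max (?X n \<omega>) (increment (n + 1) \<omega>))" for n
    using indep_rv_compose[OF ps indep_rv_pareto_factor[OF \<alpha> \<nu>, of n], of "\<lambda>p. max (fst p) (snd p)" borel]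
    by (intro indep_var_of_indep_rv[OF ps]) simp
  have total: "measure (pareto (2 * \<alpha>)) UNIV = 1"
    using prob_space.prob_space[OF prob_space_pareto[of "2 * \<alpha>"]] \<alpha> by (simp add: pareto_def)
  have Q1: "AE \<omega> in ?\<Omega>. cond_prob_given ?\<Omega> {\<omega>'\<in>space ?\<Omega>. ?Q n \<omega>' = 1}
      (borel \<Otimes>\<^sub>M borel) (\<lambda>\<omega>'. (?X n \<omega>', increment (n + 1) \<omega>')) \<omega> =
      kendall_z (?X n \<omega>) (increment (n + 1) \<omega>) powr \<alpha>" for n
  proof -
    have "{\<omega>'\<in>space ?\<Omega>. ?Q n \<omega>' = 1} = {\<omega>'\<in>space ?\<Omega>. if ?Q n \<omega>' = 1 then True else False}"
      by auto
    then show ?thesis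
      using cond_prob_given_switch[OF \<alpha> \<nu>, of "\<lambda>_ _ _. True" "\<lambda>_ _ _. False" n] by (simp add: Let_def total)
  qed
  have Q0: "AE \<omega> in ?\<Omega>. cond_prob_given ?\<Omega> {\<omega>'\<in>space ?\<Omega>. ?Q n \<omega>' = 0}
      (borel \<Otimes>\<^sub>M borel) (\<lambda>\<omega>'. (?X n \<omega>', increment (n + 1) \<omega>')) \<omega> =
      1 - kendall_z (?X n \<omega>) (increment (n + 1) \<omega>) powr \<alpha>" for n
  proof -
    have "{\<omega>'\<in>space ?\<Omega>. ?Q n \<omega>' = 0} = {\<omega>'\<in>space ?\<Omega>. if ?Q n \<omega>' = 1 then False else True}"
      by (auto simp: switch_def)
    then show ?thesis
      using cond_prob_given_switch[OF \<alpha> \<nu>, of "\<lambda>_ _ _. False" "\<lambda>_ _ _. True" n] by (simp add: Let_def total)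
  qed
  have step: "AE \<omega> in ?\<Omega>. cond_prob_given ?\<Omega> {\<omega>'\<in>space ?\<Omega>. ?X n \<omega>' \<in> A}
      (borel \<Otimes>\<^sub>M borel) (\<lambda>\<omega>'. (?X (n - 1) \<omega>', increment n \<omega>')) \<omega> =
      (let z = kendall_z (?X (n - 1) \<omega>) (increment n \<omega>); v = kendall_v (?X (n - 1) \<omega>) (increment n \<omega>) in
       z powr \<alpha> * measure (pareto (2 * \<alpha>)) {t. v * t \<in> A} + (1 - z powr \<alpha>) * indicator A v)"
    if n: "2 \<le> n" and A [measurable]: "A \<in> sets borel" for n A
  proof -
    obtain m where m: "n = m + 1" using n by (cases n) auto
    have P1: "Measurable.pred (borel \<Otimes>\<^sub>M borel \<Otimes>\<^sub>M borel)
        (\<lambda>q. max (fst q) (fst (snd q)) * snd (snd q) \<in> A)"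
      and P0: "Measurable.pred (borel \<Otimes>\<^sub>M borel \<Otimes>\<^sub>M (borel :: real measure)) (\<lambda>q. max (fst q) (fst (snd q)) \<in> A)"
      by measurable
    have event: "{\<omega>'\<in>space ?\<Omega>. ?X (m + 1) \<omega>' \<in> A} =
        {\<omega>'\<in>space ?\<Omega>. if ?Q m \<omega>' = 1
           then max (?X m \<omega>') (increment (m + 1) \<omega>') * pareto_factor m \<omega>' \<in> A
           else max (?X m \<omega>') (increment (m + 1) \<omega>') \<in> A}"
      unfolding Suc_eq_plus1[symmetric] kendall_path_recursion by (auto simp: switch_def)
    have const: "measure (pareto (2 * \<alpha>)) {t. v \<in> A} = indicator A v" for v
      by (simp add: total indicator_def)
    show ?thesis
      using cond_prob_given_switch[OF \<alpha> \<nu>, of "\<lambda>x y t. max x y * t \<in> A" "\<lambda>x y t. max x y \<in> A" m, OF P1 P0]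
      unfolding m add_diff_cancel_right' event Let_def kendall_v_def const .
  qed
  show ?thesis
  proof (intro exI conjI allI impI ballI)
    show "kendall_random_walk \<alpha> \<nu> ?\<Omega> ?X" by (rule walk)
    show "path_law M' X' = path_law ?\<Omega> ?X" if "kendall_random_walk \<alpha> \<nu> M' X'" for M' :: "'w measure" and X'
      by (rule kendall_random_walk_path_law_unique[OF \<alpha> \<nu> that walk])
    show "prob_space.indep_vars ?\<Omega> (\<lambda>_. borel) increment {1..}" by (rule indep_increment)
    show "prob_space.indep_vars ?\<Omega> (\<lambda>_. borel) pareto_factor {1..}" by (rule indep_pareto)
    show "distr ?\<Omega> borel (increment n) = \<nu>" for n
      using distr_fst_noise[OF \<alpha> \<nu>, of "n - 1"] by (simp add: increment_def[abs_def])
    show "distr ?\<Omega> borel (pareto_factor n) = pareto (2 * \<alpha>)" for n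
      by (rule distr_pareto_factor[OF \<alpha> \<nu>])
    show "?Q n \<in> measurable ?\<Omega> (count_space UNIV)" for n
      by (rule measurable_switch[OF \<alpha> \<nu>])
    show "?Q n \<omega> \<in> {0, 1}" for n \<omega>
      by (simp add: switch_def)
    show "AE \<omega> in ?\<Omega>. ?X 0 \<omega> = 0" by simp
    show "AE \<omega> in ?\<Omega>. ?X 1 \<omega> = increment 1 \<omega>" by (rule kendall_path_1[OF \<alpha> \<nu>])
    show "AE \<omega> in ?\<Omega>. ?X (n + 1) \<omega> = max (?X n \<omega>) (increment (n + 1) \<omega>) * pareto_factor n \<omega> ^ ?Q n \<omega>" for n
      by (intro AE_I2) (simp only: Suc_eq_plus1[symmetric] kendall_path_recursion)
    show "prob_space.indep_var ?\<Omega> borel (increment (n + 1)) borel (?X n)" for n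
      by (rule indep_var_of_indep_rv[OF ps indep_rv_increment_path[OF \<alpha> \<nu>]])
    show "indep_rv ?\<Omega> borel (pareto_factor n) (borel \<Otimes>\<^sub>M borel) (\<lambda>\<omega>. (?X n \<omega>, increment (n + 1) \<omega>))" for n
      by (rule indep_rv_pareto_factor[OF \<alpha> \<nu>])
  qed (rule indep_max Q1 Q0 step; assumption)+
qed

end
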